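(* Let $0<\theta<1$. Each number in the set $$\{(m^2+n^2)\theta+k:\ m,n,k\in\mathbb{Z}\}\cap(0,0.2345)$$ is the trace of a projection $e$ in $A_\theta$ satisfying $e\,\sigma(e)=0$ and $\sigma^2(e)=e$. Further, $e+\sigma(e)$ is a Fourier invariant projection, i.e. $\sigma(e+\sigma(e))=e+\sigma(e)$.
   Context: For $0<\theta<1$, $A_\theta$ denotes the rotation C*-algebra, i.e. the universal C*-algebra generated by unitaries $U,V$ satisfying $VU=\lambda UV$, where $\lambda=e^{2\pi i\theta}$. The Fourier transform is the automorphism $\sigma$ of $A_\theta$ determined by $\sigma(U)=V$, $\sigma(V)=U^{-1}$; its square $\sigma^2$ is the flip automorphism ($U\mapsto U^{-1}$, $V\mapsto V^{-1}$). The trace is the canonical normalized trace, determined by $U^mV^n\mapsto 0$ for $(m,n)\neq(0,0)$ and $1\mapsto 1$. A projection is an element $e$ with $e=e^*=e^2$. *)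

theory Defs
  imports "HOL-Analysis.Analysis"
begin

section \<open>Unital C*-algebras as types\<close>

text \<open>
  The real structure (norm, completeness, submultiplicativity, \<open>norm 1 = 1\<close>) comes from the
  library classes; a complex scalar multiplication extending \<^const>\<open>scaleR\<close> and the involution are
  added. Since \<open>norm 1 = 1\<close>, the zero algebra is not an instance.
\<close>

class cstar_algebra = real_normed_algebra_1 + banach +
  fixes scaleC :: "complex \<Rightarrow> 'a \<Rightarrow> 'a" (infixr "*\<^sub>C" 75)
    and star :: "'a \<Rightarrow> 'a"
  assumes scaleR_scaleC: "r *\<^sub>R a = complex_of_real r *\<^sub>C a"
    and scaleC_add_right: "z *\<^sub>C (a + b) = z *\<^sub>C a + z *\<^sub>C b"
    and scaleC_add_left: "(z + w) *\<^sub>C a = z *\<^sub>C a + w *\<^sub>C a"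
    and scaleC_scaleC: "z *\<^sub>C w *\<^sub>C a = (z * w) *\<^sub>C a"
    and mult_scaleC_left: "(z *\<^sub>C a) * b = z *\<^sub>C (a * b)"
    and mult_scaleC_right: "a * (z *\<^sub>C b) = z *\<^sub>C (a * b)"
    and norm_scaleC: "norm (z *\<^sub>C a) = cmod z * norm a"
    and star_add: "star (a + b) = star a + star b"
    and star_scaleC: "star (z *\<^sub>C a) = cnj z *\<^sub>C star a"
    and star_mult: "star (a * b) = star b * star a"
    and star_star: "star (star a) = a"
    and cstar_identity: "norm (star a * a) = (norm a)\<^sup>2"

definition unitary_elem :: "'a::cstar_algebra \<Rightarrow> bool"
  where "unitary_elem u \<longleftrightarrow> star u * u = 1 \<and> u * star u = 1"

definition projection :: "'a::cstar_algebra \<Rightarrow> bool"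
  where "projection e \<longleftrightarrow> star e = e \<and> e * e = e"

definition star_subalgebra :: "'a::cstar_algebra set \<Rightarrow> bool"
  where "star_subalgebra S \<longleftrightarrow> 1 \<in> S \<and>
    (\<forall>a\<in>S. \<forall>b\<in>S. a + b \<in> S \<and> a * b \<in> S) \<and> (\<forall>a\<in>S. star a \<in> S \<and> (\<forall>z. z *\<^sub>C a \<in> S))"

definition star_automorphism :: "('a::cstar_algebra \<Rightarrow> 'a) \<Rightarrow> bool"
  where "star_automorphism f \<longleftrightarrow> bij f \<and> f 1 = 1 \<and>
    (\<forall>a b. f (a + b) = f a + f b) \<and> (\<forall>a b. f (a * b) = f a * f b) \<and>
    (\<forall>z a. f (z *\<^sub>C a) = z *\<^sub>C f a) \<and> (\<forall>a. f (star a) = star (f a))"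

definition tracial_state :: "('a::cstar_algebra \<Rightarrow> complex) \<Rightarrow> bool"
  where "tracial_state t \<longleftrightarrow> bounded_linear t \<and> (\<forall>z a. t (z *\<^sub>C a) = z * t a) \<and>
    (\<forall>a. t (star a * a) \<in> \<real>\<^sub>\<ge>\<^sub>0) \<and> t 1 = 1 \<and> (\<forall>a b. t (a * b) = t (b * a))"


section \<open>Unital C*-algebras as explicit structures\<close>

text \<open>
  A universal property quantifies over all C*-algebras, which cannot be done over instances of a
  type class. Its targets are therefore C*-algebra structures on an arbitrary subset of a type,
  unrelated to any class operations on that type. The zero algebra is allowed here.
\<close>

record 'b cstar_struct =
  Carr :: "'b set"
  Zero :: 'b
  One :: 'b
  Plus :: "'b \<Rightarrow> 'b \<Rightarrow> 'b"
  Times :: "'b \<Rightarrow> 'b \<Rightarrow> 'b"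
  Scale :: "complex \<Rightarrow> 'b \<Rightarrow> 'b"
  Star :: "'b \<Rightarrow> 'b"
  Norm :: "'b \<Rightarrow> real"

locale cstar_structure =
  fixes B :: "'b cstar_struct"
  assumes closed_ops: "Zero B \<in> Carr B" "One B \<in> Carr B"
      "\<And>a b. a \<in> Carr B \<Longrightarrow> b \<in> Carr B \<Longrightarrow> Plus B a b \<in> Carr B"
      "\<And>a b. a \<in> Carr B \<Longrightarrow> b \<in> Carr B \<Longrightarrow> Times B a b \<in> Carr B"
      "\<And>z a. a \<in> Carr B \<Longrightarrow> Scale B z a \<in> Carr B"
      "\<And>a. a \<in> Carr B \<Longrightarrow> Star B a \<in> Carr B"
    and plus_assoc: "\<And>a b c. a \<in> Carr B \<Longrightarrow> b \<in> Carr B \<Longrightarrow> c \<in> Carr B \<Longrightarrow>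
      Plus B (Plus B a b) c = Plus B a (Plus B b c)"
    and plus_commute: "\<And>a b. a \<in> Carr B \<Longrightarrow> b \<in> Carr B \<Longrightarrow> Plus B a b = Plus B b a"
    and plus_zero: "\<And>a. a \<in> Carr B \<Longrightarrow> Plus B (Zero B) a = a"
    and plus_minus: "\<And>a. a \<in> Carr B \<Longrightarrow> Plus B a (Scale B (-1) a) = Zero B"
    and scale_plus: "\<And>z a b. a \<in> Carr B \<Longrightarrow> b \<in> Carr B \<Longrightarrow>
      Scale B z (Plus B a b) = Plus B (Scale B z a) (Scale B z b)"
    and scale_add: "\<And>z w a. a \<in> Carr B \<Longrightarrow>
      Scale B (z + w) a = Plus B (Scale B z a) (Scale B w a)"
    and scale_scale: "\<And>z w a. a \<in> Carr B \<Longrightarrow> Scale B z (Scale B w a) = Scale B (z * w) a"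
    and scale_one: "\<And>a. a \<in> Carr B \<Longrightarrow> Scale B 1 a = a"
    and times_assoc: "\<And>a b c. a \<in> Carr B \<Longrightarrow> b \<in> Carr B \<Longrightarrow> c \<in> Carr B \<Longrightarrow>
      Times B (Times B a b) c = Times B a (Times B b c)"
    and times_one: "\<And>a. a \<in> Carr B \<Longrightarrow> Times B (One B) a = a \<and> Times B a (One B) = a"
    and times_plus_left: "\<And>a b c. a \<in> Carr B \<Longrightarrow> b \<in> Carr B \<Longrightarrow> c \<in> Carr B \<Longrightarrow>
      Times B (Plus B a b) c = Plus B (Times B a c) (Times B b c)"
    and times_plus_right: "\<And>a b c. a \<in> Carr B \<Longrightarrow> b \<in> Carr B \<Longrightarrow> c \<in> Carr B \<Longrightarrow>
      Times B a (Plus B b c) = Plus B (Times B a b) (Times B a c)"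
    and times_scale: "\<And>z a b. a \<in> Carr B \<Longrightarrow> b \<in> Carr B \<Longrightarrow>
      Times B (Scale B z a) b = Scale B z (Times B a b) \<and>
      Times B a (Scale B z b) = Scale B z (Times B a b)"
    and star_plus: "\<And>a b. a \<in> Carr B \<Longrightarrow> b \<in> Carr B \<Longrightarrow>
      Star B (Plus B a b) = Plus B (Star B a) (Star B b)"
    and star_scale: "\<And>z a. a \<in> Carr B \<Longrightarrow> Star B (Scale B z a) = Scale B (cnj z) (Star B a)"
    and star_times: "\<And>a b. a \<in> Carr B \<Longrightarrow> b \<in> Carr B \<Longrightarrow>
      Star B (Times B a b) = Times B (Star B b) (Star B a)"
    and star_star: "\<And>a. a \<in> Carr B \<Longrightarrow> Star B (Star B a) = a"
    and norm_nonneg: "\<And>a. a \<in> Carr B \<Longrightarrow> 0 \<le> Norm B a"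
    and norm_eq_zero: "\<And>a. a \<in> Carr B \<Longrightarrow> Norm B a = 0 \<longleftrightarrow> a = Zero B"
    and norm_triangle: "\<And>a b. a \<in> Carr B \<Longrightarrow> b \<in> Carr B \<Longrightarrow>
      Norm B (Plus B a b) \<le> Norm B a + Norm B b"
    and norm_scale: "\<And>z a. a \<in> Carr B \<Longrightarrow> Norm B (Scale B z a) = cmod z * Norm B a"
    and norm_times: "\<And>a b. a \<in> Carr B \<Longrightarrow> b \<in> Carr B \<Longrightarrow>
      Norm B (Times B a b) \<le> Norm B a * Norm B b"
    and cstar_id: "\<And>a. a \<in> Carr B \<Longrightarrow> Norm B (Times B (Star B a) a) = (Norm B a)\<^sup>2"
    and complete:
      "Metric_space.mcomplete (Carr B) (\<lambda>a b. Norm B (Plus B a (Scale B (-1) b)))"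

definition unitary_in :: "'b cstar_struct \<Rightarrow> 'b \<Rightarrow> bool"
  where "unitary_in B u \<longleftrightarrow>
    u \<in> Carr B \<and> Times B (Star B u) u = One B \<and> Times B u (Star B u) = One B"

definition star_hom_into :: "'b cstar_struct \<Rightarrow> ('a::cstar_algebra \<Rightarrow> 'b) \<Rightarrow> bool"
  where "star_hom_into B f \<longleftrightarrow> range f \<subseteq> Carr B \<and> f 1 = One B \<and>
    (\<forall>a b. f (a + b) = Plus B (f a) (f b)) \<and> (\<forall>a b. f (a * b) = Times B (f a) (f b)) \<and>
    (\<forall>z a. f (z *\<^sub>C a) = Scale B z (f a)) \<and> (\<forall>a. f (star a) = Star B (f a))"

text \<open>The two notions agree: a type of class \<open>cstar_algebra\<close> is a structure on its universe.\<close>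

definition class_struct :: "'a::cstar_algebra cstar_struct"
  where "class_struct = \<lparr>Carr = UNIV, Zero = 0, One = 1, Plus = (+), Times = (*),
    Scale = scaleC, Star = star, Norm = norm\<rparr>"

lemma cstar_structure_class_struct: "cstar_structure (class_struct :: 'a::cstar_algebra cstar_struct)"
proof -
  have one: "1 *\<^sub>C a = a" for a :: 'a
    using scaleR_scaleC[of 1 a] by simp
  have minus: "(-1) *\<^sub>C a = - a" for a :: 'a
    using scaleR_scaleC[of "-1" a] by simp
  have "Metric_space.mcomplete (UNIV :: 'a set) (\<lambda>a b. norm (a - b))"
    using mcomplete_iff_complete[where ?'a = 'a] complete_UNIV[where ?'a = 'a]
    by (simp add: dist_norm[abs_def])
  then show ?thesis
    by unfold_locales
      (auto simp: class_struct_def one minus scaleC_add_right scaleC_add_left scaleC_scaleC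
        mult_scaleC_left mult_scaleC_right norm_scaleC star_add star_scaleC star_mult
        cstar_algebra_class.star_star cstar_identity norm_triangle_ineq norm_mult_ineq
        algebra_simps)
qed


section \<open>The rotation algebra, its Fourier transform and its trace\<close>

text \<open>
  \<open>rotation_algebra \<theta> U V\<close>: the type \<open>'a\<close> with \<open>U\<close>, \<open>V\<close> is the universal C*-algebra
  generated by unitaries with \<open>V U = \<lambda> U V\<close>. The target structures \<open>B\<close> of the universal property
  have their carriers inside \<open>'a\<close>. This is no restriction: the image of a homomorphism lies in the
  C*-subalgebra of the target generated by \<open>u\<close> and \<open>v\<close>, which has at most the cardinality of the
  continuum, while \<open>'a\<close> contains a copy of the complex numbers; so every such subalgebra is
  isomorphic to a structure with carrier in \<open>'a\<close>.
\<close>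

definition rotation_algebra :: "real \<Rightarrow> 'a::cstar_algebra \<Rightarrow> 'a \<Rightarrow> bool"
  where "rotation_algebra \<theta> U V \<longleftrightarrow>
    (let lam = exp (2 * complex_of_real pi * \<i> * complex_of_real \<theta>) in
      unitary_elem U \<and> unitary_elem V \<and> V * U = lam *\<^sub>C (U * V) \<and>
      (\<forall>S. star_subalgebra S \<and> closed S \<and> U \<in> S \<and> V \<in> S \<longrightarrow> S = UNIV) \<and>
      (\<forall>(B :: 'a cstar_struct) u v.
        cstar_structure B \<and> unitary_in B u \<and> unitary_in B v \<and>
        Times B v u = Scale B lam (Times B u v) \<longrightarrow>
        (\<exists>!f :: 'a \<Rightarrow> 'a. star_hom_into B f \<and> f U = u \<and> f V = v)))"

text \<open>For a unitary the inverse is the adjoint.\<close>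

definition unitary_power :: "'a::cstar_algebra \<Rightarrow> int \<Rightarrow> 'a"
  where "unitary_power u m = (if 0 \<le> m then u ^ nat m else star u ^ nat (- m))"

definition fourier_automorphism ::
  "'a::cstar_algebra \<Rightarrow> 'a \<Rightarrow> ('a \<Rightarrow> 'a) \<Rightarrow> bool"
  where "fourier_automorphism U V \<sigma> \<longleftrightarrow>
    star_automorphism \<sigma> \<and> \<sigma> U = V \<and> \<sigma> V = unitary_power U (-1)"

definition canonical_trace ::
  "'a::cstar_algebra \<Rightarrow> 'a \<Rightarrow> ('a \<Rightarrow> complex) \<Rightarrow> bool"
  where "canonical_trace U V \<tau> \<longleftrightarrow> tracial_state \<tau> \<and>
    (\<forall>m n. (m, n) \<noteq> (0, 0) \<longrightarrow> \<tau> (unitary_power U m * unitary_power V n) = 0)"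

end

theory Submission
  imports Defs
begin

text \<open>
  A suitable monomial \<open>u\<close> in \<open>U\<close> and \<open>V\<close> with exponents \<open>m\<close> and \<open>n\<close>, together with \<open>v = \<sigma> u\<close>, satisfies the
  relations of the rotation algebra for the angle \<open>(m\<^sup>2 + n\<^sup>2) \<theta>\<close>, equivalently for the angle \<open>t\<close>, and \<open>\<sigma>\<close>
  acts on the pair as its Fourier transform (\<open>fourier_pair\<close>). So the projection is sought among the
  continuous functions of \<open>u\<close> and \<open>v\<close>, and its trace has to be exactly the angle of rotation.

  A Powers-Rieffel projection \<open>p = g(u) v + f(u) + star (g(u) v)\<close> has trace \<open>t\<close>, the integral of \<open>f\<close>, and it is
  invariant under \<open>\<sigma>\<^sup>2\<close> if \<open>f\<close> is an even trapezoid (\<open>projection_pr\<close>, \<open>trace_pr\<close>, \<open>flip_pr\<close>). It is not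
  orthogonal to \<open>q = \<sigma> p\<close>, since \<open>p\<close> is localized in \<open>u\<close> and \<open>q\<close> in \<open>v\<close>. But the two are at a positive
  angle, \<open>norm (p * q) < 1\<close> (\<open>norm_pr_fourier_lt_1\<close>). Indeed \<open>f\<close> is supported on an arc of length less than
  \<open>1/4\<close> and less than \<open>2t\<close>, which is therefore disjoint from its rotation by \<open>2t\<close>. Hence \<open>p v\<^sup>2 p = 0\<close> and \<open>p (v + star v)\<^sup>2 p = 2p\<close>, so that
  \<open>p (v + star v)\<close> has norm at most \<open>sqrt 2\<close>. On the other hand \<open>q\<close> lives where
  \<open>v + star v\<close>, twice the cosine, exceeds \<open>sqrt 2\<close>.

  A positive angle suffices (\<open>orthogonalize_projection\<close>). The difference \<open>p - q\<close> changes sign under \<open>\<sigma>\<close>,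
  and zero is at most an isolated point of its spectrum. Its positive spectral projection \<open>e\<close> is
  therefore orthogonal to \<open>\<sigma> e\<close>, the negative one, and has the same trace as \<open>p\<close>.

  Two tools are developed from the C*-identity alone. Homomorphisms are contractive, because a
  self-adjoint element of norm less than one is the real part of a unitary
  (\<open>unital_star_hom_bounded_linear\<close>). Continuous functions of a unitary exist with the sup norm
  as bound, because the \<open>N\<close>-th power of a Laurent polynomial has only \<open>O(N)\<close> coefficients
  (\<open>norm_laurent_le\<close>), and Laurent polynomials are dense.
\<close>

section \<open>Adjoints and norms in C*-algebras\<close>

lemma scaleC_one [simp]: "1 *\<^sub>C a = (a::'a::cstar_algebra)"
  using scaleR_scaleC[of 1 a] by simp

lemma scaleC_zero_left [simp]: "0 *\<^sub>C a = (0::'a::cstar_algebra)"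
  using scaleR_scaleC[of 0 a] by simp

lemma scaleC_zero_right [simp]: "z *\<^sub>C 0 = (0::'a::cstar_algebra)"
  using norm_scaleC[of z "0::'a"] by simp

lemma scaleC_minus_one: "(-1) *\<^sub>C a = - (a::'a::cstar_algebra)"
  using scaleR_scaleC[of "-1" a] by simp

lemma scaleC_diff_right: "z *\<^sub>C (a - b) = z *\<^sub>C a - z *\<^sub>C (b::'a::cstar_algebra)"
  using scaleC_add_right[of z "a - b" b] by (simp add: algebra_simps)

lemma scaleC_sum_right: "z *\<^sub>C (\<Sum>i\<in>I. f i) = (\<Sum>i\<in>I. z *\<^sub>C (f i :: 'a::cstar_algebra))"
  by (induction I rule: infinite_finite_induct) (auto simp: scaleC_add_right)

lemma norm_star [simp]: "norm (star a) = norm (a::'a::cstar_algebra)"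
proof -
  have "norm b \<le> norm (star b)" for b :: 'a
  proof (cases "b = 0")
    case False
    have "norm b * norm b \<le> norm (star b) * norm b"
      using norm_mult_ineq[of "star b" b] by (simp add: cstar_identity power2_eq_square)
    with False show ?thesis by simp
  qed auto
  from this[of a] this[of "star a"] show ?thesis by (simp add: star_star)
qed

lemma bounded_linear_star: "bounded_linear (star :: 'a::cstar_algebra \<Rightarrow> 'a)"
  by (rule bounded_linear_intro[where K = 1]) (auto simp: star_add scaleR_scaleC star_scaleC)

lemma star_zero [simp]: "star 0 = (0::'a::cstar_algebra)"
  by (rule linear_0[OF bounded_linear.linear[OF bounded_linear_star]])

lemma star_minus: "star (- a) = - star (a::'a::cstar_algebra)"
  by (rule linear_neg[OF bounded_linear.linear[OF bounded_linear_star]])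

lemma star_diff: "star (a - b) = star a - star (b::'a::cstar_algebra)"
  by (rule linear_diff[OF bounded_linear.linear[OF bounded_linear_star]])

lemma star_one [simp]: "star 1 = (1::'a::cstar_algebra)"
  by (metis mult.right_neutral star_mult star_star)

lemma star_scaleR: "star (r *\<^sub>R a) = r *\<^sub>R star (a::'a::cstar_algebra)"
  by (simp add: scaleR_scaleC star_scaleC)

lemma star_power: "star (a ^ n) = star (a::'a::cstar_algebra) ^ n"
  by (induction n) (auto simp: star_mult power_commutes)

lemma norm_mult_star: "norm (a * star a) = (norm (a::'a::cstar_algebra))\<^sup>2"
  using cstar_identity[of "star a"] by (simp add: star_star)

lemma norm_isometry: "star u * u = 1 \<Longrightarrow> norm (u::'a::cstar_algebra) = 1"
  using cstar_identity[of u] by (auto simp: power2_eq_1_iff) (smt (verit) norm_ge_zero)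

lemma norm_unitary: "unitary_elem u \<Longrightarrow> norm (u::'a::cstar_algebra) = 1"
  by (auto simp: unitary_elem_def intro: norm_isometry)

lemma norm_projection_le:
  assumes "projection (p::'a::cstar_algebra)" shows "norm p \<le> 1"
proof -
  have "(norm p)\<^sup>2 = norm p"
    using cstar_identity[of p] assms by (simp add: projection_def)
  then show ?thesis
    by (auto simp: power2_eq_square)
qed

section \<open>Inverse square roots and contractivity of homomorphisms\<close>

text \<open>
  The binomial series of \<open>(1 - x) powr (-1/2)\<close>. Its argument stays in the open unit ball
  throughout, so that no spectral theory is involved.
\<close>

definition isqrt :: "'a::cstar_algebra \<Rightarrow> 'a"
  where "isqrt x = (\<Sum>k. ((-1/2::real) gchoose k) *\<^sub>R (- x) ^ k)"

lemma abs_gbinomial_minus_half_le: "\<bar>(-1/2::real) gchoose k\<bar> \<le> 1"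
proof (induction k)
  case (Suc k)
  have "(-1/2 gchoose Suc k) * (1 + real k) = - (((-1/2::real) gchoose k) * (1/2 + real k))"
    using gbinomial_mult_1[of "-1/2::real" k] by (simp add: algebra_simps)
  then have "\<bar>((-1/2::real) gchoose Suc k) * (1 + real k)\<bar> = \<bar>((-1/2::real) gchoose k) * (1/2 + real k)\<bar>"
    by (simp only: abs_minus_cancel)
  then have "\<bar>(-1/2::real) gchoose Suc k\<bar> * (1 + real k) = \<bar>(-1/2::real) gchoose k\<bar> * (1/2 + real k)"
    by (simp add: abs_mult)
  also have "\<dots> \<le> 1 * (1 + real k)"
    by (intro mult_mono Suc) auto
  finally show ?case by simp
qed auto

lemma summable_isqrt:
  assumes "norm (x::'a::cstar_algebra) < 1"
  shows "summable (\<lambda>k. norm (((-1/2::real) gchoose k) *\<^sub>R (- x) ^ k))"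
proof (rule summable_comparison_test)
  have "\<bar>(-1/2::real) gchoose k\<bar> * norm ((- x) ^ k) \<le> 1 * norm x ^ k" for k
    by (intro mult_mono abs_gbinomial_minus_half_le) (auto simp: norm_power_ineq[of "- x", simplified])
  then show "\<exists>N. \<forall>n\<ge>N. norm (norm (((-1/2::real) gchoose n) *\<^sub>R (- x) ^ n)) \<le> norm x ^ n"
    by simp
  show "summable (\<lambda>n. norm x ^ n)"
    using assms by (simp add: summable_geometric)
qed

text \<open>
  Vandermonde's identity for the exponents \<open>-1/2\<close> and \<open>-1/2\<close> collapses the Cauchy product of the
  series with itself to the geometric series.
\<close>

lemma isqrt_square:
  assumes "norm (x::'a::cstar_algebra) < 1"
  shows "isqrt x * isqrt x * (1 - x) = 1"
proof -
  let ?a = "\<lambda>k. ((-1/2::real) gchoose k) *\<^sub>R (- x) ^ k"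
  have "(\<Sum>i\<le>n. ?a i * ?a (n - i)) = x ^ n" for n
  proof -
    have "(\<Sum>i\<le>n. ?a i * ?a (n - i))
        = (\<Sum>i\<le>n. (((-1/2::real) gchoose i) * ((-1/2) gchoose (n - i))) *\<^sub>R (- x) ^ n)"
      by (intro sum.cong refl) (auto simp flip: power_add)
    also have "\<dots> = (\<Sum>i\<le>n. (((-1/2::real) gchoose i) * ((-1/2) gchoose (n - i)))) *\<^sub>R (- x) ^ n"
      by (simp add: scaleR_left.sum)
    also have "(\<Sum>i\<le>n. (((-1/2::real) gchoose i) * ((-1/2) gchoose (n - i)))) = (-1) gchoose n"
      using gbinomial_Vandermonde[of "-1/2::real" "-1/2" n] by (simp add: atLeast0AtMost)
    also have "\<dots> = (-1) ^ n"
      by (simp add: gbinomial_minus binomial_gbinomial[symmetric] del: binomial_gbinomial)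
    also have "(-1) ^ n *\<^sub>R (- x) ^ n = x ^ n"
      by (cases "even n") (auto simp: )
    finally show ?thesis .
  qed
  then have sq: "isqrt x * isqrt x = (\<Sum>n. x ^ n)"
    using Cauchy_product[OF summable_isqrt[OF assms] summable_isqrt[OF assms]]
    by (simp add: isqrt_def)
  have s: "summable (\<lambda>n. x ^ n)"
    using assms by (rule complete_algebra_summable_geometric)
  have "(\<Sum>n. x ^ n) * x = (\<Sum>n. x ^ Suc n)"
    using suminf_mult2[OF s, of x] by (simp add: power_commutes)
  also have "\<dots> = (\<Sum>n. x ^ n) - 1"
    using suminf_split_head[OF s] by simp
  finally show ?thesis
    by (simp add: sq algebra_simps)
qed

text \<open>
  All commutation rules for inverse square roots come from this one: with \<open>x = y\<close> it moves \<open>isqrt x\<close> past whatever commutes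
  with \<open>x\<close>, with \<open>y = 0\<close> it evaluates \<open>isqrt x\<close> on the kernel of \<open>x\<close>, and with \<open>x \<noteq> y\<close> it carries
  the square root from one corner of the algebra to another.
\<close>

lemma isqrt_intertwine:
  assumes "norm (x::'a::cstar_algebra) < 1" "norm y < 1" "a * x = y * a"
  shows "a * isqrt x = isqrt y * a"
proof -
  have "a * (- x) ^ k = (- y) ^ k * a" for k
  proof (induction k)
    case (Suc k)
    have "a * (- x) ^ Suc k = - (a * x * (- x) ^ k)"
      by (simp add: mult.assoc)
    also have "\<dots> = - (y * (a * (- x) ^ k))"
      by (simp add: assms mult.assoc)
    finally show ?case
      by (simp add: Suc mult.assoc)
  qed simp
  then show ?thesis
    unfolding isqrt_def
    using suminf_mult[OF summable_norm_cancel[OF summable_isqrt[OF assms(1)]], of a]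
      suminf_mult2[OF summable_norm_cancel[OF summable_isqrt[OF assms(2)]], of a]
    by simp
qed

lemma isqrt_image:
  fixes f :: "'a::cstar_algebra \<Rightarrow> 'b::cstar_algebra"
  assumes "bounded_linear f" "norm x < 1" and pow: "\<And>k. f ((- x) ^ k) = (- f x) ^ k"
  shows "f (isqrt x) = isqrt (f x)"
proof -
  interpret f: bounded_linear f by fact
  show ?thesis
    unfolding isqrt_def
    using f.suminf[OF summable_norm_cancel[OF summable_isqrt[OF assms(2)]]]
    by (simp add: f.scaleR pow)
qed

lemma star_isqrt: "norm (x::'a::cstar_algebra) < 1 \<Longrightarrow> star (isqrt x) = isqrt (star x)"
  by (rule isqrt_image) (auto simp: bounded_linear_star star_power star_minus)

definition unital_star_hom :: "('a::cstar_algebra \<Rightarrow> 'b::cstar_algebra) \<Rightarrow> bool"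
  where "unital_star_hom f \<longleftrightarrow> f 1 = 1 \<and> (\<forall>a b. f (a + b) = f a + f b) \<and>
    (\<forall>a b. f (a * b) = f a * f b) \<and> (\<forall>z a. f (z *\<^sub>C a) = z *\<^sub>C f a) \<and> (\<forall>a. f (star a) = star (f a))"

text \<open>
  Homomorphisms are contractive because norms below one can be certified algebraically: a self-adjoint
  \<open>a\<close> of norm less than one is the real part of the unitary \<open>u = a + \<i> c\<close>, where
  \<open>c = (1 - a\<^sup>2) * isqrt (a\<^sup>2)\<close> is a square root of \<open>1 - a\<^sup>2\<close>. The image of \<open>u\<close> is unitary, hence of
  norm one, and the image of \<open>a\<close> is its real part. The C*-identity reduces the general case to this one.
\<close>

lemma unital_star_hom_bounded_linear:
  assumes "unital_star_hom (\<sigma> :: 'a::cstar_algebra \<Rightarrow> 'b::cstar_algebra)"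
  shows "bounded_linear \<sigma>"
proof -
  have one: "\<sigma> 1 = 1" and add: "\<sigma> (a + b) = \<sigma> a + \<sigma> b" and mult: "\<sigma> (a * b) = \<sigma> a * \<sigma> b"
    and scale: "\<sigma> (z *\<^sub>C a) = z *\<^sub>C \<sigma> a" and st: "\<sigma> (star a) = star (\<sigma> a)" for a b z
    using assms by (auto simp: unital_star_hom_def)
  have unit_ball: "norm (\<sigma> a) \<le> 1" if sa: "star a = a" and "norm a < 1" for a
  proof -
    define c where "c = (1 - a * a) * isqrt (a * a)"
    have n: "norm (a * a) < 1"
      using that norm_mult_ineq[of a a] by (smt (verit) mult_left_le norm_ge_zero)
    have comm: "b * isqrt (a * a) = isqrt (a * a) * b" if "b * (a * a) = a * a * b" for b
      by (rule isqrt_intertwine[OF n n that])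
    have comm1: "(1 - a * a) * isqrt (a * a) = isqrt (a * a) * (1 - a * a)"
      by (rule comm) (simp add: algebra_simps)
    have "star c = isqrt (a * a) * (1 - a * a)"
      using n by (simp add: c_def star_mult star_isqrt sa star_diff)
    then have "star c = c"
      by (simp add: c_def comm1)
    moreover have ac: "a * c = c * a"
    proof -
      have "a * c = (1 - a * a) * (a * isqrt (a * a))"
        by (simp add: c_def left_diff_distrib right_diff_distrib mult.assoc)
      also have "a * isqrt (a * a) = isqrt (a * a) * a"
        by (rule comm) (simp add: mult.assoc)
      finally show ?thesis by (simp add: c_def mult.assoc)
    qed
    moreover have "a * a + c * c = 1"
    proof -
      have "c * c = (1 - a * a) * (isqrt (a * a) * isqrt (a * a) * (1 - a * a))"
        unfolding c_def by (metis comm1 mult.assoc)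
      then show ?thesis by (simp add: isqrt_square[OF n])
    qed
    moreover define u where "u = a + \<i> *\<^sub>C c"
    ultimately have su: "star u = a - \<i> *\<^sub>C c"
      using scaleC_scaleC[of "-1" \<i> c] by (simp add: star_add star_scaleC sa scaleC_minus_one)
    have "star u * u = (a - \<i> *\<^sub>C c) * a + (a - \<i> *\<^sub>C c) * (\<i> *\<^sub>C c)"
      unfolding su by (simp add: u_def distrib_left)
    also have "\<dots> = a * a + c * c"
      by (simp add: left_diff_distrib mult_scaleC_left mult_scaleC_right scaleC_scaleC
          scaleC_minus_one scaleC_diff_right ac)
    finally have "star u * u = a * a + c * c" .
    then have "star u * u = 1"
      using \<open>a * a + c * c = 1\<close> by simp
    then have nu: "norm (\<sigma> u) = 1"
      by (intro norm_isometry) (metis mult one st)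
    have "a = (1/2) *\<^sub>R (u + star u)"
      unfolding su by (simp add: u_def scaleR_add_right flip: scaleR_add_left)
    then have "\<sigma> a = (1/2) *\<^sub>R (\<sigma> u + star (\<sigma> u))"
      by (metis add scale scaleR_scaleC st)
    then show ?thesis
      using norm_triangle_ineq[of "\<sigma> u" "star (\<sigma> u)"] nu by simp
  qed
  have self_adjoint: "norm (\<sigma> a) \<le> norm a" if sa: "star a = a" for a
  proof (rule dense_ge)
    fix r assume r: "norm a < r"
    then have "r > 0" by (smt (verit) norm_ge_zero)
    then have "norm (\<sigma> ((1/r) *\<^sub>R a)) \<le> 1"
      using r by (intro unit_ball) (auto simp: star_scaleR sa)
    then show "norm (\<sigma> a) \<le> r"
      using \<open>r > 0\<close> by (simp add: scaleR_scaleC scale norm_scaleC divide_simps norm_divide)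
  qed
  have "(norm (\<sigma> a))\<^sup>2 \<le> (norm a)\<^sup>2" for a
    using self_adjoint[of "star a * a"]
    by (simp add: star_mult star_star mult st cstar_identity)
  then have "norm (\<sigma> a) \<le> norm a" for a
    by (rule power2_le_imp_le) simp
  then show ?thesis
    by (intro bounded_linear_intro[where K = 1]) (auto simp: add scaleR_scaleC scale)
qed

section \<open>Laurent polynomials in a unitary\<close>

definition poly_eval :: "complex poly \<Rightarrow> 'a::cstar_algebra \<Rightarrow> 'a"
  where "poly_eval P u = (\<Sum>i\<le>degree P. coeff P i *\<^sub>C u ^ i)"

lemma poly_eval_upto: "degree P \<le> n \<Longrightarrow> poly_eval P u = (\<Sum>i\<le>n. coeff P i *\<^sub>C u ^ i)"
  unfolding poly_eval_def by (rule sum.mono_neutral_left) (auto simp: coeff_eq_0)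

lemma poly_eval_0 [simp]: "poly_eval 0 u = 0"
  by (simp add: poly_eval_def)

lemma poly_eval_pCons: "poly_eval (pCons c P) u = c *\<^sub>C 1 + u * poly_eval P u"
proof -
  have "poly_eval (pCons c P) u = (\<Sum>i\<le>Suc (degree P). coeff (pCons c P) i *\<^sub>C u ^ i)"
    by (rule poly_eval_upto) (rule degree_pCons_le)
  also have "\<dots> = c *\<^sub>C 1 + (\<Sum>i\<le>degree P. coeff P i *\<^sub>C (u * u ^ i))"
    by (subst sum.atMost_Suc_shift) simp
  finally show ?thesis
    by (simp add: poly_eval_def sum_distrib_left mult_scaleC_right)
qed

lemma poly_eval_add: "poly_eval (P + Q) u = poly_eval P u + poly_eval Q u"
proof -
  let ?n = "max (degree P) (degree Q)"
  have "poly_eval (P + Q) u = (\<Sum>i\<le>?n. coeff (P + Q) i *\<^sub>C u ^ i)"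
    by (rule poly_eval_upto) (rule degree_add_le_max)
  then show ?thesis
    by (simp add: poly_eval_upto[of P ?n] poly_eval_upto[of Q ?n] scaleC_add_left sum.distrib)
qed

lemma poly_eval_smult: "poly_eval (smult c P) u = c *\<^sub>C poly_eval P u"
  by (simp add: poly_eval_upto[OF degree_smult_le] scaleC_sum_right scaleC_scaleC poly_eval_def)

lemma poly_eval_commute:
  assumes "b * u = u * b" shows "b * poly_eval P u = poly_eval P u * b"
proof -
  have "b * u ^ i = u ^ i * b" for i
    using assms by (metis power_commuting_commutes)
  then show ?thesis
    by (simp add: poly_eval_def sum_distrib_left sum_distrib_right mult_scaleC_left mult_scaleC_right)
qed

lemma poly_eval_mult: "poly_eval (P * Q) u = poly_eval P u * poly_eval Q u"
proof (induction P)
  case (pCons c P)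
  have "poly_eval (pCons c P * Q) u = poly_eval (smult c Q) u + poly_eval (pCons 0 (P * Q)) u"
    by (simp add: poly_eval_add)
  then show ?case
    by (simp add: poly_eval_smult poly_eval_pCons pCons.IH distrib_right mult_scaleC_left mult.assoc)
qed simp

lemma poly_eval_monom: "poly_eval (monom 1 k) u = u ^ k"
proof (induction k)
  case 0
  show ?case by (simp add: monom_0 poly_eval_pCons)
next
  case (Suc k)
  then show ?case by (simp add: monom_Suc poly_eval_pCons)
qed

lemma circle_orthogonality:
  "((\<lambda>x. cnj (cis (2*pi*x)) ^ i * cis (2*pi*x) ^ j) has_integral (if i = j then 1 else 0)) {-1/2..1/2}"
proof (cases "i = j")
  case True
  have "cnj (cis (2*pi*x)) ^ i * cis (2*pi*x) ^ j = 1" for x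
    using True by (simp add: power_mult_distrib[symmetric] cis_cnj cis_mult)
  then show ?thesis
    using True has_integral_const_real[of "1::complex" "-1/2" "1/2"] by simp
next
  case False
  define k where "k = 2 * pi * (real j - real i)"
  have k: "k \<noteq> 0" using False by (simp add: k_def)
  have eq: "cnj (cis (2*pi*x)) ^ i * cis (2*pi*x) ^ j = cis (k * x)" for x
  proof -
    have "cnj (cis (2*pi*x)) ^ i * cis (2*pi*x) ^ j = cis (real i * - (2*pi*x) + real j * (2*pi*x))"
      by (simp only: cis_cnj Complex.DeMoivre cis_mult)
    also have "real i * - (2*pi*x) + real j * (2*pi*x) = k * x"
      by (simp add: k_def algebra_simps)
    finally show ?thesis .
  qed
  have D: "((\<lambda>x. cis (k * x) / (\<i> * of_real k)) has_vector_derivative cis (k * x)) (at x within S)" for x S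
  proof -
    have "((\<lambda>x. exp (\<i> * (of_real k * of_real x)) / (\<i> * of_real k)) has_vector_derivative
        (of_real k * (\<i> * exp (\<i> * (of_real k * of_real x))) / (\<i> * of_real k))) (at x within S)"
      by (auto intro!: derivative_eq_intros has_vector_derivative_real_field
         has_vector_derivative_divide simp: field_simps k)
    then show ?thesis using k by (simp add: cis_conv_exp)
  qed
  have "((\<lambda>x. cis (k * x)) has_integral
      (cis (k * (1/2)) / (\<i> * of_real k) - cis (k * (-1/2)) / (\<i> * of_real k))) {-1/2..1/2}"
    by (rule fundamental_theorem_of_calculus) (auto intro: D)
  moreover have "cis (k * (1/2)) = cis (k * (-1/2))"
  proof -
    have "cis (k * (1/2)) = cis (k * (-1/2)) * cis (2 * pi * of_int (int j - int i))"
      by (simp add: cis_mult k_def field_simps)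
    then show ?thesis by (simp add: cis_multiple_2pi)
  qed
  ultimately show ?thesis using False by (simp add: eq)
qed

text \<open>
  Cauchy's estimate on the unit circle, read off from the orthogonality of the characters of the circle.
\<close>

lemma coeff_le_sup_circle:
  fixes Q :: "complex poly"
  assumes B: "\<And>z. norm z = 1 \<Longrightarrow> norm (poly Q z) \<le> B"
  shows "norm (coeff Q i) \<le> B"
proof -
  have "((\<lambda>x. \<Sum>j\<le>degree Q. coeff Q j * (cnj (cis (2*pi*x)) ^ i * cis (2*pi*x) ^ j)) has_integral
      (\<Sum>j\<le>degree Q. coeff Q j * (if i = j then 1 else 0))) {-1/2..1/2}"
    by (intro has_integral_sum has_integral_mult_right circle_orthogonality) auto
  moreover have "(\<Sum>j\<le>degree Q. coeff Q j * (if i = j then 1 else 0)) = coeff Q i"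
    by (auto simp: if_distrib sum.delta cong: if_cong) (simp add: coeff_eq_0)
  moreover have "norm (\<Sum>j\<le>degree Q. coeff Q j * (cnj (cis (2*pi*x)) ^ i * cis (2*pi*x) ^ j)) \<le> B" for x
  proof -
    have "(\<Sum>j\<le>degree Q. coeff Q j * (cnj (cis (2*pi*x)) ^ i * cis (2*pi*x) ^ j))
        = cnj (cis (2*pi*x)) ^ i * poly Q (cis (2*pi*x))"
      by (simp add: poly_altdef sum_distrib_left mult_ac)
    then show ?thesis by (simp add: norm_mult norm_power B)
  qed
  moreover have "0 \<le> B"
    using B[of 1] norm_ge_zero[of "poly Q 1"] by (simp del: norm_ge_zero)
  ultimately show ?thesis
    using has_integral_bound_real[of B "{}" _ "coeff Q i" "-1/2" "1/2"] by simp
qed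

text \<open>
  The graph of the evaluation of Laurent polynomials at \<open>u\<close>, as the star algebra generated by the pair of
  the coordinate function and \<open>u\<close>. Keeping function and value together makes every compatibility of
  the functional calculus (adjoints, homomorphisms, substitutions) a rule induction on the generators;
  that the value depends only on the function on the circle is then a consequence of the norm bound.
\<close>

inductive laurent :: "'a::cstar_algebra \<Rightarrow> (complex \<Rightarrow> complex) \<Rightarrow> 'a \<Rightarrow> bool" for u
  where const: "laurent u (\<lambda>z. c) (c *\<^sub>C 1)"
  | ident: "laurent u (\<lambda>z. z) u"
  | conj: "laurent u cnj (star u)"
  | add: "laurent u F a \<Longrightarrow> laurent u G b \<Longrightarrow> laurent u (\<lambda>z. F z + G z) (a + b)"
  | mult: "laurent u F a \<Longrightarrow> laurent u G b \<Longrightarrow> laurent u (\<lambda>z. F z * G z) (a * b)"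

lemma laurent_star: "laurent u F a \<Longrightarrow> laurent u (\<lambda>z. cnj (F z)) (star a)"
proof (induction rule: laurent.induct)
  case (const c)
  show ?case using laurent.const[of u "cnj c"] by (simp add: star_scaleC)
next
  case (mult F a G b)
  then show ?case using laurent.mult[OF mult.IH(2,1)] by (simp add: star_mult mult.commute)
qed (auto simp: star_add star_star intro: laurent.intros)

lemma laurent_diff:
  assumes "laurent u F a" "laurent u G b" shows "laurent u (\<lambda>z. F z - G z) (a - b)"
  using laurent.add[OF assms(1) laurent.mult[OF laurent.const[of u "-1"] assms(2)]]
  by (simp add: mult_scaleC_left scaleC_minus_one)

lemma laurent_continuous: "laurent u F a \<Longrightarrow> continuous_on S F"
  by (induction rule: laurent.induct) (auto intro!: continuous_intros)

text \<open>
  One substitution principle covers the three uses made of it: \<open>\<phi>\<close> the identity and \<open>T\<close> arbitrary,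
  \<open>\<phi>\<close> a rotation and \<open>T\<close> conjugation by a unitary, \<open>\<phi>\<close> the complex conjugation and \<open>T\<close> the identity.
\<close>

lemma laurent_substitute:
  assumes T: "unital_star_hom T" and w: "laurent w \<phi> (T u)" and L: "laurent u F a"
  shows "laurent w (\<lambda>z. F (\<phi> z)) (T a)"
  using L
proof (induction rule: laurent.induct)
  case (const c)
  then show ?case using T laurent.const[of w c] by (simp add: unital_star_hom_def)
next
  case conj
  then show ?case using T laurent_star[OF w] by (simp add: unital_star_hom_def)
qed (use T w in \<open>auto simp: unital_star_hom_def intro: laurent.intros\<close>)

text \<open>
  The normal form \<open>cnj z ^ n * poly P z\<close> of a Laurent polynomial with exponents between \<open>-n\<close> and \<open>n\<close>. It keeps
  track of the degree, which grows only linearly when powers are taken.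
\<close>

definition laurent_poly :: "'a::cstar_algebra \<Rightarrow> nat \<Rightarrow> complex poly \<Rightarrow> (complex \<Rightarrow> complex) \<Rightarrow> 'a \<Rightarrow> bool"
  where "laurent_poly u n P F a \<longleftrightarrow> degree P \<le> 2 * n \<and>
    (\<forall>z. norm z = 1 \<longrightarrow> F z = cnj z ^ n * poly P z) \<and> a = star u ^ n * poly_eval P u"

lemma star_power_mult_power: "unitary_elem u \<Longrightarrow> star u ^ k * u ^ k = (1::'a::cstar_algebra)"
proof (induction k)
  case (Suc k)
  have "star u ^ Suc k * u ^ Suc k = star u ^ k * (star u * u) * u ^ k"
    by (simp add: mult.assoc power_Suc2 del: power_Suc) (simp add: power_commutes)
  then show ?case using Suc by (simp add: unitary_elem_def)
qed simp

lemma cnj_power_mult_power: "norm z = 1 \<Longrightarrow> cnj z ^ k * z ^ k = 1"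
  by (simp add: power_mult_distrib[symmetric] complex_norm_square[symmetric] mult.commute)

lemma laurent_poly_raise:
  assumes u: "unitary_elem u" and P: "laurent_poly u n P F a"
  shows "laurent_poly u (n + k) (P * monom 1 k) F a"
proof -
  have "degree (P * monom 1 k) \<le> 2 * (n + k)"
    using degree_mult_le[of P "monom 1 k"] degree_monom_le[of "1::complex" k] P
    by (simp add: laurent_poly_def)
  moreover have "star u ^ (n + k) * poly_eval (P * monom 1 k) u = star u ^ n * poly_eval P u"
  proof -
    have "poly_eval P u * u ^ k = u ^ k * poly_eval P u"
      by (simp add: poly_eval_commute power_commutes)
    then have "star u ^ (n + k) * poly_eval (P * monom 1 k) u
        = star u ^ n * (star u ^ k * u ^ k) * poly_eval P u"
      by (simp add: poly_eval_mult poly_eval_monom power_add mult.assoc)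
    then show ?thesis by (simp add: star_power_mult_power u)
  qed
  moreover have "cnj z ^ (n + k) * poly (P * monom 1 k) z = cnj z ^ n * poly P z" if "norm z = 1" for z
  proof -
    have "cnj z ^ (n + k) * poly (P * monom 1 k) z = cnj z ^ n * poly P z * (cnj z ^ k * z ^ k)"
      by (simp add: power_add poly_monom mult_ac)
    then show ?thesis using that by (simp only: cnj_power_mult_power mult_1_right)
  qed
  ultimately show ?thesis
    using P unfolding laurent_poly_def by metis
qed

lemma laurent_poly_mult:
  assumes u: "unitary_elem u" and P: "laurent_poly u n P F a" and Q: "laurent_poly u m Q G b"
  shows "laurent_poly u (n + m) (P * Q) (\<lambda>z. F z * G z) (a * b)"
proof -
  have "star u * u = u * star u"
    using u by (simp add: unitary_elem_def)
  then have "star u ^ m * u = u * star u ^ m"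
    by (metis power_commuting_commutes)
  then have "poly_eval P u * star u ^ m = star u ^ m * poly_eval P u"
    by (simp add: poly_eval_commute)
  then have "a * b = star u ^ (n + m) * poly_eval (P * Q) u"
    using P Q by (simp add: laurent_poly_def poly_eval_mult power_add) (metis mult.assoc)
  moreover have "degree (P * Q) \<le> 2 * (n + m)"
    using degree_mult_le[of P Q] P Q by (simp add: laurent_poly_def)
  ultimately show ?thesis
    using P Q by (simp add: laurent_poly_def power_add mult_ac)
qed

lemma laurent_poly_add:
  assumes u: "unitary_elem u" and P: "laurent_poly u n P F a" and Q: "laurent_poly u m Q G b"
  shows "\<exists>n P. laurent_poly u n P (\<lambda>z. F z + G z) (a + b)"
proof -
  obtain P' where P': "laurent_poly u (n + m) P' F a"
    using laurent_poly_raise[OF u P] by blast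
  obtain Q' where Q': "laurent_poly u (n + m) Q' G b"
    using laurent_poly_raise[OF u Q, of n] by (auto simp: add.commute)
  have "laurent_poly u (n + m) (P' + Q') (\<lambda>z. F z + G z) (a + b)"
    using P' Q' by (simp add: laurent_poly_def degree_add_le poly_eval_add distrib_left)
  then show ?thesis by blast
qed

lemma laurent_poly_power:
  assumes u: "unitary_elem u" and P: "laurent_poly u n P F a"
  shows "laurent_poly u (n * k) (P ^ k) (\<lambda>z. F z ^ k) (a ^ k)"
proof (induction k)
  case 0
  then show ?case by (simp add: laurent_poly_def one_pCons poly_eval_pCons)
next
  case (Suc k)
  then show ?case using laurent_poly_mult[OF u P Suc] by (simp add: add.commute)
qed

lemma laurent_imp_poly:
  assumes u: "unitary_elem u" and "laurent u F a"
  shows "\<exists>n P. laurent_poly u n P F a"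
  using assms(2)
proof (induction rule: laurent.induct)
  case (const c)
  have "laurent_poly u 0 [:c:] (\<lambda>z. c) (c *\<^sub>C 1)"
    by (simp add: laurent_poly_def poly_eval_pCons)
  then show ?case by blast
next
  case ident
  have "laurent_poly u 1 (monom 1 2) (\<lambda>z. z) u"
    using u cnj_power_mult_power[where k = 1]
    by (auto simp: laurent_poly_def poly_eval_monom degree_monom_eq poly_monom unitary_elem_def
        power2_eq_square mult.assoc[symmetric])
  then show ?case by blast
next
  case conj
  have "laurent_poly u 1 1 cnj (star u)"
    by (simp add: laurent_poly_def one_pCons poly_eval_pCons)
  then show ?case by blast
next
  case (add F a G b)
  then show ?case using laurent_poly_add[OF u] by blast
next
  case (mult F a G b)
  then show ?case using laurent_poly_mult[OF u] by blast
qed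

text \<open>
  A crude bound, off by the number of coefficients.
\<close>

lemma norm_laurent_poly_le:
  assumes u: "unitary_elem u" and P: "laurent_poly u n P F a"
    and B: "\<And>z. norm z = 1 \<Longrightarrow> norm (F z) \<le> B"
  shows "norm a \<le> real (2 * n + 1) * B"
proof -
  have PB: "norm (poly P z) \<le> B" if "norm z = 1" for z
    using B[OF that] P that by (simp add: laurent_poly_def norm_mult norm_power)
  have "norm a \<le> norm (star u ^ n) * norm (poly_eval P u)"
    using P by (simp add: laurent_poly_def norm_mult_ineq)
  also have "\<dots> \<le> 1 * norm (poly_eval P u)"
    using norm_power_ineq[of "star u" n] norm_unitary[OF u] by (intro mult_right_mono) auto
  also have "\<dots> = norm (\<Sum>i\<le>2*n. coeff P i *\<^sub>C u ^ i)"
    using P poly_eval_upto[of P "2 * n" u] by (simp add: laurent_poly_def)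
  also have "\<dots> \<le> (\<Sum>i\<le>2*n. B)"
  proof (rule sum_norm_le)
    fix i
    have "norm (coeff P i) * norm (u ^ i) \<le> B * 1"
      using norm_power_ineq[of u i] norm_unitary[OF u]
      by (intro mult_mono coeff_le_sup_circle PB) (auto intro: order_trans[OF norm_ge_zero PB[of 1]])
    then show "norm (coeff P i *\<^sub>C u ^ i) \<le> B" by (simp add: norm_scaleC)
  qed
  finally show ?thesis by simp
qed

lemma self_adjoint_norm_power:
  assumes "star a = (a::'a::cstar_algebra)"
  shows "norm (a ^ (2 ^ j)) = norm a ^ (2 ^ j)"
proof (induction j)
  case (Suc j)
  have "norm (a ^ (2 ^ Suc j)) = norm (star (a ^ (2 ^ j)) * a ^ (2 ^ j))"
    by (simp add: star_power assms power_add[symmetric] mult_2)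
  also have "\<dots> = (norm (a ^ (2 ^ j)))\<^sup>2"
    by (rule cstar_identity)
  finally show ?case by (simp add: Suc power_mult[symmetric] mult.commute)
qed simp

text \<open>
  The crude bound becomes sharp by taking powers. For self-adjoint \<open>b\<close> the C*-identity gives
  \<open>norm (b ^ N) = norm b ^ N\<close> when \<open>N\<close> is a power of two, while the Laurent polynomial of \<open>b ^ N\<close> has
  only \<open>2nN + 1\<close> coefficients, each at most \<open>C ^ N\<close>. The linear factor cannot compensate an
  exponential gap, so \<open>norm b \<le> C\<close>.
\<close>

lemma norm_laurent_le:
  assumes u: "unitary_elem u" and L: "laurent u F a"
    and B: "\<And>z. norm z = 1 \<Longrightarrow> norm (F z) \<le> B"
  shows "norm a \<le> B"
proof -
  have self_adjoint: "norm b \<le> C"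
    if L: "laurent u G b" and C: "\<And>z. norm z = 1 \<Longrightarrow> norm (G z) \<le> C" and sa: "star b = b" for G b C
  proof (rule dense_ge)
    fix r assume "C < r"
    show "norm b \<le> r"
    proof (rule ccontr)
      assume nb: "\<not> norm b \<le> r"
      have r: "r > 0" using C[of 1] \<open>C < r\<close> norm_ge_zero[of "G 1"] by (simp del: norm_ge_zero)
      define \<rho> where "\<rho> = norm b / r"
      have \<rho>: "\<rho> > 1" using nb r by (simp add: \<rho>_def)
      obtain n P where P: "laurent_poly u n P G b"
        using laurent_imp_poly[OF u L] by blast
      have le: "\<rho> ^ (2 ^ j) \<le> 2 * real n * real (2 ^ j) + 1" for j
      proof -
        let ?N = "2 ^ j :: nat"
        have "norm b ^ ?N \<le> real (2 * (n * ?N) + 1) * r ^ ?N"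
          unfolding self_adjoint_norm_power[OF sa, symmetric]
          by (rule norm_laurent_poly_le[OF u laurent_poly_power[OF u P]])
             (use C \<open>C < r\<close> in \<open>auto simp: norm_power intro!: power_mono intro: order_trans less_imp_le\<close>)
        then show ?thesis
          using r by (simp add: \<rho>_def power_divide divide_simps algebra_simps)
      qed
      have "(\<lambda>N. 2 * real n * (real N / \<rho> ^ N) + 1 / \<rho> ^ N) \<longlonglongrightarrow> 2 * real n * 0 + 0"
        using \<rho> lim_n_over_pown[of \<rho>] LIMSEQ_inverse_realpow_zero[of \<rho>]
        by (intro tendsto_intros) (auto simp: inverse_eq_divide)
      then have "\<forall>\<^sub>F N in sequentially. 2 * real n * (real N / \<rho> ^ N) + 1 / \<rho> ^ N < 1"
        by (intro order_tendstoD(2)) auto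
      then obtain N0 where N0: "\<And>N. N \<ge> N0 \<Longrightarrow> 2 * real n * (real N / \<rho> ^ N) + 1 / \<rho> ^ N < 1"
        by (auto simp: eventually_sequentially)
      \<comment> \<open>\<open>2 ^ N0\<close> is a power of two beyond the threshold \<open>N0\<close>.\<close>
      have "2 * real n * (real (2 ^ N0) / \<rho> ^ (2 ^ N0)) + 1 / \<rho> ^ (2 ^ N0) < 1"
        by (rule N0) (simp add: less_imp_le)
      then have "2 * real n * real (2 ^ N0) + 1 < \<rho> ^ (2 ^ N0)"
        using \<rho> by (simp add: field_simps)
      with le[of N0] show False by simp
    qed
  qed
  have "norm (star a * a) \<le> B\<^sup>2"
  proof (rule self_adjoint)
    show "laurent u (\<lambda>z. cnj (F z) * F z) (star a * a)"
      by (intro laurent.mult laurent_star L)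
    show "norm (cnj (F z) * F z) \<le> B\<^sup>2" if "norm z = 1" for z
      using B[OF that] by (simp add: norm_mult power2_eq_square mult_mono')
  qed (simp add: star_mult star_star)
  moreover have "0 \<le> B"
    using B[of 1] norm_ge_zero[of "F 1"] by (simp del: norm_ge_zero)
  ultimately show ?thesis
    by (simp add: cstar_identity abs_le_square_iff[symmetric])
qed

section \<open>The continuous functional calculus of a unitary\<close>

abbreviation circle :: "complex set"
  where "circle \<equiv> sphere 0 1"

text \<open>
  The closure of the graph of Laurent evaluation in the uniform norm on the circle times the norm of
  the algebra. The norm bound makes it the graph of a function, and the Stone-Weierstrass theorem
  makes its domain all of the continuous functions.
\<close>

definition laurent_limit :: "'a::cstar_algebra \<Rightarrow> (complex \<Rightarrow> complex) \<Rightarrow> 'a \<Rightarrow> bool"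
  where "laurent_limit u F a \<longleftrightarrow> (\<exists>P b. (\<forall>n::nat. laurent u (P n) (b n)) \<and>
    uniform_limit circle P F sequentially \<and> b \<longlonglongrightarrow> a)"

lemma laurent_limitI:
  "(\<And>n::nat. laurent u (P n) (b n)) \<Longrightarrow> uniform_limit circle P F sequentially \<Longrightarrow> b \<longlonglongrightarrow> a \<Longrightarrow>
    laurent_limit u F a"
  by (auto simp: laurent_limit_def)

lemma laurent_imp_limit: "laurent u F a \<Longrightarrow> laurent_limit u F a"
  by (rule laurent_limitI[where P = "\<lambda>_. F" and b = "\<lambda>_. a"]) (auto intro: uniform_limit_const)

lemma laurent_limit_continuous: "laurent_limit u F a \<Longrightarrow> continuous_on circle F"
  unfolding laurent_limit_def
  using laurent_continuous uniform_limit_theorem[OF always_eventually _ sequentially_bot] by blast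

lemma laurent_limit_bounded: "laurent_limit u F a \<Longrightarrow> bounded (F ` circle)"
  by (intro compact_imp_bounded compact_continuous_image laurent_limit_continuous) auto

lemma laurent_limit_add:
  assumes "laurent_limit u F a" "laurent_limit u G b"
  shows "laurent_limit u (\<lambda>z. F z + G z) (a + b)"
proof -
  obtain P c where P: "\<forall>n::nat. laurent u (P n) (c n)" "uniform_limit circle P F sequentially" "c \<longlonglongrightarrow> a"
    using assms(1) unfolding laurent_limit_def by blast
  obtain Q d where Q: "\<forall>n::nat. laurent u (Q n) (d n)" "uniform_limit circle Q G sequentially" "d \<longlonglongrightarrow> b"
    using assms(2) unfolding laurent_limit_def by blast
  show ?thesis
    by (rule laurent_limitI[where P = "\<lambda>n z. P n z + Q n z" and b = "\<lambda>n. c n + d n"])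
       (use P Q in \<open>auto intro: laurent.add uniform_limit_add tendsto_add\<close>)
qed

lemma laurent_limit_mult:
  assumes "laurent_limit u F a" "laurent_limit u G b"
  shows "laurent_limit u (\<lambda>z. F z * G z) (a * b)"
proof -
  obtain P c where P: "\<forall>n::nat. laurent u (P n) (c n)" "uniform_limit circle P F sequentially" "c \<longlonglongrightarrow> a"
    using assms(1) unfolding laurent_limit_def by blast
  obtain Q d where Q: "\<forall>n::nat. laurent u (Q n) (d n)" "uniform_limit circle Q G sequentially" "d \<longlonglongrightarrow> b"
    using assms(2) unfolding laurent_limit_def by blast
  have "uniform_limit circle (\<lambda>n z. P n z * Q n z) (\<lambda>z. F z * G z) sequentially"
    by (intro bounded_bilinear.bounded_uniform_limit[OF bounded_bilinear_mult] P Q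
        laurent_limit_bounded[OF assms(1)] laurent_limit_bounded[OF assms(2)])
  then show ?thesis
    by (rule laurent_limitI[rotated, where b = "\<lambda>n. c n * d n"])
       (use P Q in \<open>auto intro: laurent.mult tendsto_mult\<close>)
qed

lemma laurent_limit_substitute:
  assumes T: "unital_star_hom T" and w: "laurent w \<phi> (T u)"
    and \<phi>: "\<And>z. norm z = 1 \<Longrightarrow> norm (\<phi> z) = 1" and L: "laurent_limit u F a"
  shows "laurent_limit w (\<lambda>z. F (\<phi> z)) (T a)"
proof -
  obtain P c where P: "\<forall>n::nat. laurent u (P n) (c n)" "uniform_limit circle P F sequentially" "c \<longlonglongrightarrow> a"
    using L unfolding laurent_limit_def by blast
  show ?thesis
  proof (rule laurent_limitI)
    show "laurent w (\<lambda>z. P n (\<phi> z)) (T (c n))" for n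
      using P(1) by (intro laurent_substitute[OF T w]) auto
    show "uniform_limit circle (\<lambda>n z. P n (\<phi> z)) (\<lambda>z. F (\<phi> z)) sequentially"
      by (rule uniform_limit_compose'[OF P(2)]) (auto simp: \<phi>)
    show "(\<lambda>n. T (c n)) \<longlonglongrightarrow> T a"
      by (rule bounded_linear.tendsto[OF unital_star_hom_bounded_linear[OF T] P(3)])
  qed
qed

lemma laurent_limit_star:
  assumes "laurent_limit u F a" shows "laurent_limit u (\<lambda>z. cnj (F z)) (star a)"
proof -
  obtain P c where P: "\<forall>n::nat. laurent u (P n) (c n)" "uniform_limit circle P F sequentially" "c \<longlonglongrightarrow> a"
    using assms unfolding laurent_limit_def by blast
  show ?thesis
  proof (rule laurent_limitI)
    show "laurent u (\<lambda>z. cnj (P n z)) (star (c n))" for n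
      using P(1) by (intro laurent_star) auto
    show "uniform_limit circle (\<lambda>n z. cnj (P n z)) (\<lambda>z. cnj (F z)) sequentially"
      by (rule bounded_linear.uniform_limit[OF bounded_linear_cnj P(2)])
    show "(\<lambda>n. star (c n)) \<longlonglongrightarrow> star a"
      by (rule bounded_linear.tendsto[OF bounded_linear_star P(3)])
  qed
qed

lemma norm_laurent_limit_le:
  assumes u: "unitary_elem u" and L: "laurent_limit u F a"
    and B: "\<And>z. norm z = 1 \<Longrightarrow> norm (F z) \<le> B"
  shows "norm a \<le> B"
proof (rule field_le_epsilon)
  fix e :: real assume e: "e > 0"
  obtain P b where P: "\<forall>n::nat. laurent u (P n) (b n)" "uniform_limit circle P F sequentially" "b \<longlonglongrightarrow> a"
    using L unfolding laurent_limit_def by blast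
  have "\<forall>\<^sub>F n in sequentially. norm (b n) \<le> B + e"
    using uniform_limitD[OF P(2) e]
  proof eventually_elim
    case (elim n)
    show ?case
    proof (rule norm_laurent_le[OF u])
      show "laurent u (P n) (b n)" using P(1) by blast
      show "norm (P n z) \<le> B + e" if "norm z = 1" for z
        using elim[rule_format, of z] B[OF that] that norm_triangle_ineq2[of "P n z" "F z"]
        by (auto simp: dist_norm)
    qed
  qed
  then show "norm a \<le> B + e"
    by (intro tendsto_upperbound[OF tendsto_norm[OF P(3)]]) auto
qed

lemma laurent_limit_unique:
  assumes u: "unitary_elem u" and "laurent_limit u F a" "laurent_limit u G b"
    and "\<And>z. norm z = 1 \<Longrightarrow> F z = G z"
  shows "a = b"
proof -
  have "laurent_limit u (\<lambda>z. F z + (-1) * G z) (a + ((-1) *\<^sub>C 1) * b)"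
    by (rule laurent_limit_add[OF assms(2) laurent_limit_mult[OF laurent_imp_limit[OF laurent.const] assms(3)]])
  then have "norm (a + ((-1) *\<^sub>C 1) * b) \<le> 0"
    by (rule norm_laurent_limit_le[OF u]) (simp add: assms(4))
  then show ?thesis
    by (simp add: mult_scaleC_left scaleC_minus_one)
qed

text \<open>
  A real-linear functional of \<open>z\<close> is a combination of \<open>z\<close> and \<open>cnj z\<close>, so real polynomials in the
  coordinates are Laurent polynomials on the circle.
\<close>

lemma laurent_real_polynomial:
  fixes g :: "complex \<Rightarrow> real"
  assumes "real_polynomial_function g"
  shows "\<exists>a. laurent u (\<lambda>z. complex_of_real (g z)) a"
  using assms
proof (induction rule: real_polynomial_function.induct)
  case (linear f)
  then interpret f: bounded_linear f .
  define \<alpha> where "\<alpha> = (complex_of_real (f 1) - \<i> * complex_of_real (f \<i>)) / 2"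
  have "complex_of_real (f z) = \<alpha> * z + cnj \<alpha> * cnj z" for z
  proof -
    have "f z = f (Re z *\<^sub>R 1 + Im z *\<^sub>R \<i>)"
      by (rule arg_cong[where f = f]) (simp add: complex_eq_iff)
    also have "\<dots> = Re z * f 1 + Im z * f \<i>"
      by (simp only: f.add f.scaleR) simp
    finally show ?thesis
      by (simp add: complex_eq_iff \<alpha>_def algebra_simps add_divide_distrib diff_divide_distrib)
  qed
  then show ?case
    using laurent.add[OF laurent.mult[OF laurent.const[of u \<alpha>] laurent.ident]
       laurent.mult[OF laurent.const[of u "cnj \<alpha>"] laurent.conj]]
    by auto
next
  case (const c)
  then show ?case using laurent.const by blast
next
  case (add f g)
  then show ?case using laurent.add by fastforce
next
  case (mult f g)
  then show ?case using laurent.mult by fastforce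
qed

lemma laurent_dense:
  assumes F: "continuous_on circle F" and e: "e > 0"
  shows "\<exists>P b. laurent u P b \<and> (\<forall>z\<in>circle. norm (P z - F z) < e)"
proof -
  obtain g where g: "polynomial_function g" "\<And>z. z \<in> circle \<Longrightarrow> norm (F z - g z) < e"
    using Stone_Weierstrass_polynomial_function[OF compact_sphere F e] by blast
  have "real_polynomial_function (Re \<circ> g)" "real_polynomial_function (Im \<circ> g)"
    using g(1) bounded_linear_Re bounded_linear_Im by (auto simp: polynomial_function_def)
  then obtain a b where "laurent u (\<lambda>z. complex_of_real (Re (g z))) a" "laurent u (\<lambda>z. complex_of_real (Im (g z))) b"
    using laurent_real_polynomial[of "Re \<circ> g" u] laurent_real_polynomial[of "Im \<circ> g" u] by auto
  then have "laurent u (\<lambda>z. complex_of_real (Re (g z)) + \<i> * complex_of_real (Im (g z))) (a + (\<i> *\<^sub>C 1) * b)"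
    by (intro laurent.add laurent.mult laurent.const)
  then have "laurent u g (a + (\<i> *\<^sub>C 1) * b)"
    by (simp only: complex_eq[symmetric])
  then show ?thesis
    using g(2) by (metis norm_minus_commute)
qed

lemma laurent_limit_exists:
  assumes u: "unitary_elem u" and F: "continuous_on circle F"
  shows "\<exists>a. laurent_limit u F a"
proof -
  have "\<forall>n::nat. \<exists>P b. laurent u P b \<and> (\<forall>z\<in>circle. norm (P z - F z) < inverse (real (Suc n)))"
    by (intro allI laurent_dense F) simp
  then obtain P b where L: "\<And>n::nat. laurent u (P n) (b n)"
    and P: "\<And>n z. z \<in> circle \<Longrightarrow> norm (P n z - F z) < inverse (real (Suc n))"
    by metis
  have small: "\<exists>N. \<forall>n\<ge>N. inverse (real (Suc n)) < e" if e: "e > 0" for e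
  proof -
    obtain N where N: "inverse (real (Suc N)) < e"
      using reals_Archimedean[OF e] by blast
    have "inverse (real (Suc n)) \<le> inverse (real (Suc N))" if "n \<ge> N" for n
      using that by (intro le_imp_inverse_le) auto
    with N show ?thesis by (meson le_less_trans)
  qed
  have "Cauchy b"
  proof (rule metric_CauchyI)
    fix e :: real assume e: "e > 0"
    obtain N where N: "\<forall>n\<ge>N. inverse (real (Suc n)) < e/3"
      using small[of "e/3"] e by auto
    have "dist (b m) (b n) < e" if "m \<ge> N" "n \<ge> N" for m n
    proof -
      have "norm (b m - b n) \<le> 2 * (e/3)"
      proof (rule norm_laurent_le[OF u laurent_diff[OF L L]])
        fix z :: complex assume "norm z = 1"
        then have z: "z \<in> circle" by simp
        have "norm (P m z - P n z) \<le> norm (P m z - F z) + norm (P n z - F z)"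
          using norm_triangle_ineq4[of "P m z - F z" "P n z - F z"] by simp
        also have "\<dots> \<le> e/3 + e/3"
          using P[OF z, of m] P[OF z, of n] N that by (intro add_mono) (meson less_le_trans less_imp_le order_trans)+
        finally show "norm (P m z - P n z) \<le> 2 * (e/3)" by simp
      qed
      with e show ?thesis by (simp add: dist_norm)
    qed
    then show "\<exists>N. \<forall>m\<ge>N. \<forall>n\<ge>N. dist (b m) (b n) < e" by blast
  qed
  then obtain a where a: "b \<longlonglongrightarrow> a"
    using Cauchy_convergent convergent_def by blast
  have "uniform_limit circle P F sequentially"
    unfolding uniform_limit_sequentially_iff
    using small P by (metis dist_norm less_trans)
  with L a show ?thesis
    by (intro exI laurent_limitI)
qed

definition fun_calc :: "'a::cstar_algebra \<Rightarrow> (complex \<Rightarrow> complex) \<Rightarrow> 'a"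
  where "fun_calc u F = (THE a. laurent_limit u F a)"

lemma fun_calc_eqI: "unitary_elem u \<Longrightarrow> laurent_limit u F a \<Longrightarrow> fun_calc u F = a"
  unfolding fun_calc_def by (rule the_equality) (auto intro: laurent_limit_unique)

lemma fun_calc_limit:
  "unitary_elem u \<Longrightarrow> continuous_on circle F \<Longrightarrow> laurent_limit u F (fun_calc u F)"
  using laurent_limit_exists fun_calc_eqI by metis

lemma fun_calc_cong:
  assumes "unitary_elem u" "continuous_on circle F" "\<And>z. norm z = 1 \<Longrightarrow> F z = G z"
  shows "fun_calc u F = fun_calc u G"
proof -
  have "continuous_on circle G"
    using assms(2) by (rule continuous_on_cong[THEN iffD1, OF refl, rotated]) (use assms(3) in auto)
  then show ?thesis
    using assms by (metis fun_calc_limit laurent_limit_unique)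
qed

lemma fun_calc_const: "unitary_elem u \<Longrightarrow> fun_calc u (\<lambda>z. c) = c *\<^sub>C 1"
  by (intro fun_calc_eqI laurent_imp_limit laurent.const)

lemma fun_calc_add:
  "unitary_elem u \<Longrightarrow> continuous_on circle F \<Longrightarrow> continuous_on circle G \<Longrightarrow>
    fun_calc u (\<lambda>z. F z + G z) = fun_calc u F + fun_calc u G"
  by (rule fun_calc_eqI[OF _ laurent_limit_add[OF fun_calc_limit fun_calc_limit]])

lemma fun_calc_mult:
  "unitary_elem u \<Longrightarrow> continuous_on circle F \<Longrightarrow> continuous_on circle G \<Longrightarrow>
    fun_calc u (\<lambda>z. F z * G z) = fun_calc u F * fun_calc u G"
  by (rule fun_calc_eqI[OF _ laurent_limit_mult[OF fun_calc_limit fun_calc_limit]])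

lemma star_fun_calc:
  "unitary_elem u \<Longrightarrow> continuous_on circle F \<Longrightarrow> star (fun_calc u F) = fun_calc u (\<lambda>z. cnj (F z))"
  by (rule fun_calc_eqI[OF _ laurent_limit_star[OF fun_calc_limit], symmetric])

lemma norm_fun_calc_le:
  "unitary_elem u \<Longrightarrow> continuous_on circle F \<Longrightarrow> (\<And>z. norm z = 1 \<Longrightarrow> norm (F z) \<le> B) \<Longrightarrow>
    norm (fun_calc u F) \<le> B"
  by (rule norm_laurent_limit_le[OF _ fun_calc_limit])

lemma fun_calc_substitute:
  assumes "unital_star_hom T" "unitary_elem u" "unitary_elem w" "laurent w \<phi> (T u)"
    and "\<And>z. norm z = 1 \<Longrightarrow> norm (\<phi> z) = 1" and "continuous_on circle F"
  shows "T (fun_calc u F) = fun_calc w (\<lambda>z. F (\<phi> z))"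
  using fun_calc_eqI[OF assms(3) laurent_limit_substitute[OF assms(1,4,5) fun_calc_limit[OF assms(2,6)]]] by simp

lemma unital_star_hom_unitary: "unital_star_hom T \<Longrightarrow> unitary_elem u \<Longrightarrow> unitary_elem (T u)"
  unfolding unital_star_hom_def unitary_elem_def by metis

lemma fun_calc_hom:
  assumes "unital_star_hom T" "unitary_elem u" "continuous_on circle F"
  shows "T (fun_calc u F) = fun_calc (T u) F"
  using assms by (intro fun_calc_substitute[where \<phi> = "\<lambda>z. z"]) (auto intro: laurent.ident unital_star_hom_unitary)

lemma unitary_star: "unitary_elem u \<Longrightarrow> unitary_elem (star u)"
  by (simp add: unitary_elem_def star_star)

lemma fun_calc_star_unitary:
  assumes "unitary_elem u" "continuous_on circle F"
  shows "fun_calc (star u) F = fun_calc u (\<lambda>z. F (cnj z))"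
  using assms fun_calc_substitute[where T = "\<lambda>a. a" and u = "star u" and w = u and \<phi> = cnj and F = F]
  by (auto simp: unital_star_hom_def intro: laurent.conj unitary_star)

text \<open>
  Conjugation by \<open>v\<close> rotates \<open>u\<close> by \<open>c\<close>, hence rotates the argument of every function of \<open>u\<close>.
\<close>

lemma fun_calc_rotate:
  assumes u: "unitary_elem u" and v: "unitary_elem v" and vu: "v * u = c *\<^sub>C (u * v)" and c: "norm c = 1"
    and F: "continuous_on circle F"
  shows "v * fun_calc u F = fun_calc u (\<lambda>z. F (c * z)) * v"
proof -
  have vv: "star v * v = 1" "v * star v = 1" "v * (star v * a) = a" "star v * (v * a) = a" for a
    using v by (auto simp: unitary_elem_def) (auto simp flip: mult.assoc simp: unitary_elem_def)
  have "unital_star_hom (\<lambda>a. v * a * star v)"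
    by (auto simp: unital_star_hom_def vv distrib_left distrib_right mult.assoc star_mult star_star
        mult_scaleC_left mult_scaleC_right)
  moreover have "v * u * star v = c *\<^sub>C u"
    by (simp add: vu mult_scaleC_left mult.assoc vv)
  then have "laurent u (\<lambda>z. c * z) (v * u * star v)"
    using laurent.mult[OF laurent.const[of u c] laurent.ident] by (simp add: mult_scaleC_left)
  ultimately have "v * fun_calc u F * star v = fun_calc u (\<lambda>z. F (c * z))"
    by (rule fun_calc_substitute[OF _ u u]) (use c F in \<open>auto simp: norm_mult\<close>)
  then show ?thesis
    by (metis mult.assoc mult.right_neutral vv(1))
qed

text \<open>
  A functional that annihilates the non-zero powers of \<open>u\<close> integrates functions of \<open>u\<close> over the circle.
\<close>

lemma fun_calc_trace:
  assumes u: "unitary_elem u" and F: "continuous_on circle F"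
    and \<tau>: "bounded_linear \<tau>" "\<And>z a. \<tau> (z *\<^sub>C a) = z * \<tau> a"
    and moments: "\<And>n i. \<tau> (star u ^ n * u ^ i) = (if n = i then 1 else 0)"
  shows "((\<lambda>x. F (cis (2*pi*x))) has_integral \<tau> (fun_calc u F)) {-1/2..1/2}"
proof -
  interpret \<tau>: bounded_linear \<tau> by fact
  have laurent: "((\<lambda>x. P (cis (2*pi*x))) has_integral \<tau> b) {-1/2..1/2}" if L: "laurent u P b" for P b
  proof -
    obtain n Q where Q: "laurent_poly u n Q P b"
      using laurent_imp_poly[OF u L] by blast
    have "((\<lambda>x. \<Sum>j\<le>degree Q. coeff Q j * (cnj (cis (2*pi*x)) ^ n * cis (2*pi*x) ^ j)) has_integral
      (\<Sum>j\<le>degree Q. coeff Q j * (if n = j then 1 else 0))) {-1/2..1/2}"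
      by (intro has_integral_sum has_integral_mult_right circle_orthogonality) auto
    moreover have "(\<lambda>x. \<Sum>j\<le>degree Q. coeff Q j * (cnj (cis (2*pi*x)) ^ n * cis (2*pi*x) ^ j)) = (\<lambda>x. P (cis (2*pi*x)))"
      using Q by (auto simp: laurent_poly_def poly_altdef sum_distrib_left mult_ac)
    moreover have "\<tau> b = (\<Sum>j\<le>degree Q. coeff Q j * (if n = j then 1 else 0))"
      using Q by (simp add: laurent_poly_def poly_eval_def sum_distrib_left \<tau>.sum mult_scaleC_right \<tau>(2) moments)
    ultimately show ?thesis by simp
  qed
  obtain P b where P: "\<forall>n::nat. laurent u (P n) (b n)" "uniform_limit circle P F sequentially"
      "b \<longlonglongrightarrow> fun_calc u F"
    using fun_calc_limit[OF u F] unfolding laurent_limit_def by blast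
  have "uniform_limit {-1/2..1/2::real} (\<lambda>n x. P n (cis (2*pi*x))) (\<lambda>x. F (cis (2*pi*x))) sequentially"
    by (rule uniform_limit_compose'[OF P(2)]) auto
  moreover have "continuous_on {-1/2..1/2} (\<lambda>x. P n (cis (2*pi*x)))" for n
    by (rule continuous_on_compose2[OF laurent_continuous[OF P(1)[rule_format], of UNIV]])
       (auto intro!: continuous_intros)
  ultimately obtain I J where I: "\<And>n. ((\<lambda>x. P n (cis (2*pi*x))) has_integral I n) {-1/2..1/2}"
      and J: "((\<lambda>x. F (cis (2*pi*x))) has_integral J) {-1/2..1/2}" "I \<longlonglongrightarrow> J"
    by (rule uniform_limit_integral) auto
  have "I n = \<tau> (b n)" for n
    using I laurent P(1) has_integral_unique by blast
  then have "I = (\<lambda>n. \<tau> (b n))" by (rule ext)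
  then have "(\<lambda>n. \<tau> (b n)) \<longlonglongrightarrow> J" using J(2) by (simp only:)
  with \<tau>.tendsto[OF P(3)] have "J = \<tau> (fun_calc u F)"
    using LIMSEQ_unique by blast
  with J(1) show ?thesis by simp
qed

section \<open>The sign of a difference of two projections\<close>

lemma isqrt_0: "isqrt 0 = (1::'a::cstar_algebra)"
proof -
  have "(\<lambda>k. ((-1/2::real) gchoose k) *\<^sub>R (- 0 :: 'a) ^ k) sums (\<Sum>k\<in>{0::nat}. ((-1/2::real) gchoose k) *\<^sub>R (- 0 :: 'a) ^ k)"
    by (rule sums_finite) (auto simp: power_0_left)
  then show ?thesis
    unfolding isqrt_def by (simp add: sums_iff)
qed

text \<open>
  The two compressions \<open>p q p\<close> and \<open>q p q\<close> have equal moments under a trace.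
\<close>

lemma tracial_isqrt_swap:
  fixes p q :: "'a::cstar_algebra"
  assumes \<tau>: "tracial_state \<tau>" and p: "p * p = p" and q: "q * q = q"
    and n: "norm (p * q * p) < 1" "norm (q * p * q) < 1"
  shows "\<tau> (isqrt (p * q * p)) = \<tau> (isqrt (q * p * q))"
proof -
  interpret \<tau>: bounded_linear \<tau> using \<tau> by (simp add: tracial_state_def)
  have cyc: "\<tau> (a * b) = \<tau> (b * a)" for a b using \<tau> by (simp add: tracial_state_def)
  have pp: "p * (p * z) = p * z" and qq: "q * (q * z) = q * z" for z
    using p q by (simp_all flip: mult.assoc)
  let ?x = "p * q * p" and ?y = "q * p * q"
  have swap: "?x ^ k * (p * q) = p * q * ?y ^ k" for k
  proof (induction k)
    case (Suc k)
    have "?x ^ Suc k * (p * q) = ?x * (?x ^ k * (p * q))"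
      by (simp add: mult.assoc)
    also have "\<dots> = p * q * ?y ^ Suc k"
      unfolding Suc by (simp add: mult.assoc pp qq)
    finally show ?case .
  qed simp
  have pow: "\<tau> (?x ^ k) = \<tau> (?y ^ k)" for k
  proof (cases k)
    case (Suc j)
    have "\<tau> (?x ^ k) = \<tau> (?x ^ j * (p * q) * (q * p))"
      by (simp add: Suc power_Suc2 mult.assoc qq del: power_Suc)
    also have "\<dots> = \<tau> ((q * p) * (p * q * ?y ^ j))"
      by (simp only: swap cyc)
    also have "\<dots> = \<tau> (?y ^ k)"
      by (simp add: Suc mult.assoc pp)
    finally show ?thesis .
  qed simp
  have "\<tau> ((- ?x) ^ k) = \<tau> ((- ?y) ^ k)" for k
    using pow[of k] power_minus[of ?x k] power_minus[of ?y k]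
    by (cases "even k") (simp_all add: \<tau>.neg)
  then show ?thesis
    unfolding isqrt_def
    using \<tau>.suminf[OF summable_norm_cancel[OF summable_isqrt[OF n(1)]]]
      \<tau>.suminf[OF summable_norm_cancel[OF summable_isqrt[OF n(2)]]]
    by (simp add: \<tau>.scaleR)
qed

text \<open>
  Let \<open>q = \<sigma> p\<close>. Two projections with \<open>norm (p * q) < 1\<close> should be thought of as a family of pairs of
  lines, each pair spanning a plane and forming an angle \<open>\<alpha>\<close> bounded away from zero. In such a plane, \<open>p - q\<close> has the eigenvalues \<open>\<plusminus> sin \<alpha>\<close>, and
  its eigenvectors are the orthonormal pair placed symmetrically to the two lines. As \<open>\<sigma>\<close> changes the
  sign of \<open>p - q\<close>, it exchanges the two spectral projections; the positive one is the required \<open>e\<close>.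

  The sign \<open>X\<close> of \<open>p - q\<close> is \<open>p - q\<close> divided by \<open>sin \<alpha>\<close>. On the range of \<open>p\<close> the square of the cosine is
  \<open>x = p q p\<close>, on the range of \<open>q\<close> it is \<open>y = q p q\<close>; so \<open>X = r p - s q\<close> with \<open>r\<close> and \<open>s\<close> the inverse square
  roots of \<open>1 - x\<close> and \<open>1 - y\<close>. The rest is algebra: \<open>X ^ 3 = X\<close>, whence \<open>X\<^sup>2\<close> is a projection and
  \<open>(X\<^sup>2 + X) / 2\<close> is the projection onto the eigenvalue one. The trace identities
  \<open>\<tau> (X\<^sup>2) = \<tau> p + \<tau> q\<close> and \<open>\<tau> X = \<tau> p - \<tau> q\<close> add up to \<open>\<tau> e = \<tau> p\<close>.
\<close>

lemma orthogonalize_projection: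
  fixes p :: "'a::cstar_algebra"
  assumes \<sigma>: "unital_star_hom \<sigma>" and \<tau>: "tracial_state \<tau>"
    and p: "projection p" and flip: "\<sigma> (\<sigma> p) = p" and angle: "norm (p * \<sigma> p) < 1"
  shows "\<exists>e. projection e \<and> \<tau> e = \<tau> p \<and> e * \<sigma> e = 0 \<and> \<sigma> (\<sigma> e) = e \<and>
    projection (e + \<sigma> e) \<and> \<sigma> (e + \<sigma> e) = e + \<sigma> e"
proof -
  interpret \<tau>: bounded_linear \<tau> using \<tau> by (simp add: tracial_state_def)
  interpret \<sigma>: bounded_linear \<sigma> by (rule unital_star_hom_bounded_linear[OF \<sigma>])
  have cyc: "\<tau> (a * b) = \<tau> (b * a)" for a b using \<tau> by (simp add: tracial_state_def)
  have \<sigma>_mult: "\<sigma> (a * b) = \<sigma> a * \<sigma> b" and \<sigma>_one: "\<sigma> 1 = 1" and \<sigma>_star: "\<sigma> (star a) = star (\<sigma> a)" for a b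
    using \<sigma> by (auto simp: unital_star_hom_def)
  have \<sigma>_power: "\<sigma> (a ^ k) = \<sigma> a ^ k" for a k
    by (induction k) (auto simp: \<sigma>_one \<sigma>_mult)
  define q where "q = \<sigma> p"
  have \<sigma>q: "\<sigma> q = p" by (simp add: q_def flip)
  have p2: "p * p = p" and sp: "star p = p" using p by (auto simp: projection_def)
  have q2: "q * q = q" and sq: "star q = q" by (simp_all add: q_def p2 sp flip: \<sigma>_mult \<sigma>_star)
  have "projection q" by (simp add: projection_def q2 sq)
  have pp: "p * (p * z) = p * z" and qq: "q * (q * z) = q * z" for z
    using p2 q2 by (simp_all flip: mult.assoc)
  define x where "x = p * q * p"
  define y where "y = q * p * q"
  have nx: "norm x < 1"
    using norm_mult_ineq[of "p * q" p] norm_projection_le[OF p] angle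
    by (smt (verit) mult_left_le norm_ge_zero q_def x_def)
  have ny: "norm y < 1"
    using norm_mult_ineq[of q "p * q"] norm_projection_le[OF \<open>projection q\<close>] angle
    by (smt (verit) mult_left_le_one_le norm_ge_zero q_def y_def mult.assoc)
  define r where "r = isqrt x"
  define s where "s = isqrt y"
  have pr: "p * r = r * p"
    unfolding r_def by (rule isqrt_intertwine[OF nx nx]) (simp add: x_def mult.assoc p2 pp)
  have qs: "q * s = s * q"
    unfolding s_def by (rule isqrt_intertwine[OF ny ny]) (simp add: y_def mult.assoc q2 qq)
  have pqs: "p * q * s = r * (p * q)"
    unfolding r_def s_def
    by (rule isqrt_intertwine[OF ny nx]) (simp add: x_def y_def mult.assoc pp qq)
  have qpr: "q * p * r = s * (q * p)"
    unfolding r_def s_def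
    by (rule isqrt_intertwine[OF nx ny]) (simp add: x_def y_def mult.assoc pp qq)
  \<comment> \<open>These rules move \<open>r\<close> and \<open>s\<close> to the left of \<open>p\<close> and \<open>q\<close>, turning one into the other where needed.\<close>
  have psq: "p * (s * q) = r * (p * q)" and qrp: "q * (r * p) = s * (q * p)"
    using pqs qpr by (simp_all add: mult.assoc pr qs)
  \<comment> \<open>The equation \<open>r\<^sup>2 * (1 - x) * p = p\<close> in the normal form used by the simplifier.\<close>
  have rrx: "r * (r * (p * (q * p))) = r * (r * p) - p"
  proof -
    have "r * r * (1 - x) * p = p"
      unfolding r_def by (simp add: isqrt_square[OF nx])
    then show ?thesis
      by (simp add: x_def algebra_simps p2 mult.assoc)
  qed
  have ssy: "s * (s * (q * (p * q))) = s * (s * q) - q"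
  proof -
    have "s * s * (1 - y) * q = q"
      unfolding s_def by (simp add: isqrt_square[OF ny])
    then show ?thesis
      by (simp add: y_def algebra_simps q2 mult.assoc)
  qed
  have left: "p * (r * z) = r * (p * z)" "q * (s * z) = s * (q * z)"
    "p * (s * (q * z)) = r * (p * (q * z))" "q * (r * (p * z)) = s * (q * (p * z))" for z
    using pr qs psq qrp by (metis mult.assoc)+
  note rules = mult.assoc p2 q2 pp qq pr qs psq qrp left rrx ssy
  define X where "X = r * p - s * q"
  have XX: "X * X = r * (r * p) - r * (r * (p * q)) - s * (s * (q * p)) + s * (s * q)"
    by (simp add: X_def left_diff_distrib right_diff_distrib rules)
  have X3: "X * X * X = X"
    unfolding XX by (simp add: X_def left_diff_distrib right_diff_distrib distrib_left distrib_right rules)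
  have "star x = x" "star y = y"
    by (simp_all add: x_def y_def star_mult sp sq mult.assoc)
  then have "star r = r" "star s = s"
    by (simp_all add: r_def s_def star_isqrt nx ny)
  then have sX: "star X = X"
    by (simp add: X_def star_diff star_mult sp sq pr qs)
  have "\<sigma> x = y" "\<sigma> y = x"
    by (simp_all add: x_def y_def \<sigma>_mult \<sigma>q) (simp_all add: q_def)
  then have "\<sigma> r = s" "\<sigma> s = r"
    unfolding r_def s_def
    using isqrt_image[OF \<sigma>.bounded_linear_axioms nx] isqrt_image[OF \<sigma>.bounded_linear_axioms ny]
    by (simp_all add: \<sigma>_power \<sigma>.neg)
  then have \<sigma>X: "\<sigma> X = - X"
    by (simp add: X_def \<sigma>.diff \<sigma>_mult \<sigma>q) (simp add: q_def)
  have \<tau>XX: "\<tau> (X * X) = \<tau> p + \<tau> q"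
  proof -
    have "\<tau> (r * (r * (p * q))) = \<tau> (p * (r * (r * (p * q))))"
      by (simp add: rules)
    also have "\<dots> = \<tau> (r * (r * p)) - \<tau> p"
      by (subst cyc) (simp add: rules \<tau>.diff)
    finally have 1: "\<tau> (r * (r * (p * q))) = \<tau> (r * (r * p)) - \<tau> p" .
    have "\<tau> (s * (s * (q * p))) = \<tau> (q * (s * (s * (q * p))))"
      by (simp add: rules)
    also have "\<dots> = \<tau> (s * (s * q)) - \<tau> q"
      by (subst cyc) (simp add: rules \<tau>.diff)
    finally show ?thesis
      using 1 by (simp add: XX \<tau>.add \<tau>.diff)
  qed
  have \<tau>X: "\<tau> X = \<tau> p - \<tau> q"
  proof -
    \<comment> \<open>Off the range of \<open>p\<close> the square root \<open>r\<close> is the identity, and so is \<open>s\<close> off the range of \<open>q\<close>.\<close>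
    have "(1 - p) * r = isqrt 0 * (1 - p)" "(1 - q) * s = isqrt 0 * (1 - q)"
      unfolding r_def s_def
      by (rule isqrt_intertwine[OF nx] isqrt_intertwine[OF ny];
          simp add: x_def y_def left_diff_distrib mult.assoc pp qq)+
    then have "r * p = r - 1 + p" "s * q = s - 1 + q"
      by (simp_all add: isqrt_0 left_diff_distrib pr qs algebra_simps)
    moreover have "\<tau> r = \<tau> s"
      using tracial_isqrt_swap[OF \<tau> p2 q2] nx ny by (simp add: r_def s_def x_def y_def)
    ultimately show ?thesis
      by (simp add: X_def \<tau>.add \<tau>.diff)
  qed
  define e where "e = (1/2) *\<^sub>R (X * X + X)"
  have \<sigma>e: "\<sigma> e = (1/2) *\<^sub>R (X * X - X)"
    by (simp add: e_def \<sigma>.scaleR \<sigma>.add \<sigma>_mult \<sigma>X)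
  have X4: "X * X * (X * X) = X * X" and X3': "X * (X * X) = X"
    using X3 by (simp_all flip: mult.assoc)
  have "(X * X + X) * (X * X + X) = 2 *\<^sub>R (X * X + X)"
    by (simp add: distrib_left distrib_right X4 X3 X3' scaleR_2)
  then have ee: "e * e = e"
    by (simp add: e_def)
  have se: "star e = e"
    by (simp add: e_def star_scaleR star_add star_mult sX)
  have e\<sigma>e: "e * \<sigma> e = 0"
    by (simp add: \<sigma>e) (simp add: e_def distrib_right right_diff_distrib X4 X3 X3')
  have \<sigma>\<sigma>e: "\<sigma> (\<sigma> e) = e"
    by (simp add: \<sigma>e \<sigma>.scaleR \<sigma>.diff \<sigma>_mult \<sigma>X) (simp add: e_def)
  have sum: "e + \<sigma> e = X * X"
    by (simp add: \<sigma>e) (simp add: e_def flip: scaleR_add_right scaleR_2)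
  have "\<tau> e = \<tau> p"
    by (simp add: e_def \<tau>.scaleR \<tau>.add \<tau>XX \<tau>X flip: scaleR_2)
  moreover have "projection (e + \<sigma> e)"
    unfolding sum by (simp add: projection_def star_mult sX X4)
  moreover have "\<sigma> (e + \<sigma> e) = e + \<sigma> e"
    by (simp add: \<sigma>.add \<sigma>\<sigma>e add.commute)
  ultimately show ?thesis
    using ee se e\<sigma>e \<sigma>\<sigma>e by (auto simp: projection_def)
qed

section \<open>Trapezoids on the circle\<close>

text \<open>
  The distance of \<open>z\<close> from \<open>1\<close> along the circle, with total length one. It is written through the real
  part, so that it is visibly continuous and invariant under conjugation.
\<close>

definition angle :: "complex \<Rightarrow> real"
  where "angle z = arccos (Re z) / (2 * pi)"

lemma abs_Re_circle: "norm z = 1 \<Longrightarrow> \<bar>Re z\<bar> \<le> 1"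
  using abs_Re_le_cmod[of z] by simp

lemma continuous_angle: "continuous_on circle angle"
  unfolding angle_def
  by (intro continuous_intros continuous_on_arccos) (auto dest!: abs_Re_circle)

lemma angle_cnj: "angle (cnj z) = angle z"
  by (simp add: angle_def)

lemma angle_cis: "\<bar>x\<bar> \<le> 1/2 \<Longrightarrow> angle (cis (2*pi*x)) = \<bar>x\<bar>"
proof -
  assume x: "\<bar>x\<bar> \<le> 1/2"
  have "cos (2*pi*x) = cos (2*pi*\<bar>x\<bar>)"
    by (cases "x \<ge> 0") auto
  moreover have "arccos (cos (2*pi*\<bar>x\<bar>)) = 2*pi*\<bar>x\<bar>"
    using x by (intro arccos_cos) (auto simp: mult_left_le)
  ultimately show ?thesis by (simp add: angle_def)
qed

lemma angle_cis_ge: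
  assumes "c \<le> x" "x \<le> 1 - c" "0 \<le> c" shows "c \<le> angle (cis (2*pi*x))"
proof (cases "x \<le> 1/2")
  case True
  then show ?thesis using assms by (simp add: angle_cis)
next
  case False
  have "cis (2*pi*x) = cis (2*pi*(x-1))"
  proof -
    have "cis (2*pi*(x-1)) * cis (2*pi) = cis (2*pi*x)"
      unfolding cis_mult by (simp add: algebra_simps)
    then show ?thesis by simp
  qed
  then show ?thesis using assms False by (simp add: angle_cis)
qed

lemma circle_param:
  assumes "norm z = 1" obtains x where "\<bar>x\<bar> \<le> 1/2" "z = cis (2*pi*x)"
proof
  show "\<bar>Arg z / (2*pi)\<bar> \<le> 1/2"
    using Arg_bounded[of z] by (auto simp: divide_simps abs_le_iff)
  show "z = cis (2*pi*(Arg z / (2*pi)))"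
    using assms cis_Arg[of z] by (cases "z = 0") (auto simp: sgn_eq)
qed

lemma cos_le_Re: "norm z = 1 \<Longrightarrow> angle z \<le> b \<Longrightarrow> b \<le> 1/2 \<Longrightarrow> cos (2*pi*b) \<le> Re z"
proof -
  assume z: "norm z = 1" and b: "angle z \<le> b" "b \<le> 1/2"
  have "cos (2*pi*b) \<le> cos (arccos (Re z))"
    using b abs_Re_circle[OF z] arccos_lbound[of "Re z"]
    by (intro cos_monotone_0_pi_le) (auto simp: angle_def field_simps)
  then show ?thesis using abs_Re_circle[OF z] by (simp add: cos_arccos)
qed

definition trapezoid :: "real \<Rightarrow> real \<Rightarrow> real \<Rightarrow> real"
  where "trapezoid a b y = (max 0 (b - y) - max 0 (a - y)) / (b - a)"

lemma trapezoid_nonneg: "a < b \<Longrightarrow> 0 \<le> trapezoid a b y"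
  by (simp add: trapezoid_def)

lemma trapezoid_eq_0: "a < b \<Longrightarrow> b \<le> y \<Longrightarrow> trapezoid a b y = 0"
  by (simp add: trapezoid_def)

lemma trapezoid_eq_1: "a < b \<Longrightarrow> y \<le> a \<Longrightarrow> trapezoid a b y = 1"
  by (simp add: trapezoid_def)

text \<open>
  Opposite slopes add up to one; this is what makes neighbouring translates of a trapezoid a partition
  of unity on the overlap.
\<close>

lemma trapezoid_complement: "a < b \<Longrightarrow> trapezoid a b y + trapezoid a b (a + b - y) = 1"
proof -
  assume "a < b"
  have "max 0 (b - y) - max 0 (a - y) + (max 0 (b - (a + b - y)) - max 0 (a - (a + b - y))) = b - a"
    by (simp add: max_def)
  with \<open>a < b\<close> show ?thesis
    unfolding trapezoid_def add_divide_distrib[symmetric] by simp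
qed

lemma has_integral_tent:
  assumes "0 \<le> c" "c \<le> 1/2"
  shows "((\<lambda>x. max 0 (c - \<bar>x\<bar>)) has_integral c\<^sup>2) {-1/2..1/2::real}"
proof -
  have "((\<lambda>x. c - x) has_integral (c * c - c\<^sup>2/2) - (c * 0 - 0\<^sup>2/2)) {0..c}"
    by (rule fundamental_theorem_of_calculus)
       (use assms in \<open>auto intro!: derivative_eq_intros simp flip: has_real_derivative_iff_has_vector_derivative\<close>)
  then have 1: "((\<lambda>x. max 0 (c - \<bar>x\<bar>)) has_integral c\<^sup>2/2) {0..c}"
    by (rule has_integral_eq[rotated, THEN has_integral_eq_rhs]) (auto simp: power2_eq_square)
  have 2: "((\<lambda>x. max 0 (c - \<bar>x\<bar>)) has_integral 0) {c..1/2}"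
    by (rule has_integral_is_0) (use assms in auto)
  have R: "((\<lambda>x. max 0 (c - \<bar>x\<bar>)) has_integral c\<^sup>2/2 + 0) {0..1/2}"
    using assms by (intro has_integral_combine[OF _ _ 1 2]) auto
  then have L: "((\<lambda>x. max 0 (c - \<bar>x\<bar>)) has_integral c\<^sup>2/2) {-1/2..0}"
    using has_integral_reflect_real[of "\<lambda>x. max 0 (c - \<bar>x\<bar>)" _ "1/2" 0] by simp
  show ?thesis
    using has_integral_combine[OF _ _ L R] by simp
qed

lemma has_integral_trapezoid:
  assumes "0 \<le> a" "a < b" "b \<le> 1/2"
  shows "((\<lambda>x. trapezoid a b \<bar>x\<bar>) has_integral (a + b)) {-1/2..1/2::real}"
proof -
  have "((\<lambda>x. (max 0 (b - \<bar>x\<bar>) - max 0 (a - \<bar>x\<bar>)) / (b - a)) has_integral (b\<^sup>2 - a\<^sup>2) / (b - a)) {-1/2..1/2::real}"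
    using assms by (intro has_integral_divide has_integral_diff has_integral_tent) auto
  moreover have "(b\<^sup>2 - a\<^sup>2) / (b - a) = a + b"
  proof -
    have "(b\<^sup>2 - a\<^sup>2) / (b - a) = ((a + b) * (b - a)) / (b - a)"
      by (rule arg_cong2[where f = "(/)"]) (auto simp: power2_eq_square algebra_simps)
    also have "\<dots> = a + b"
      using assms by (intro nonzero_mult_div_cancel_right) simp
    finally show ?thesis .
  qed
  ultimately show ?thesis by (simp add: trapezoid_def)
qed

section \<open>The Powers-Rieffel projection\<close>

text \<open>
  The pair \<open>u\<close>, \<open>v\<close> satisfies the relations of the rotation algebra for the angle \<open>t\<close>. The number \<open>\<delta>\<close> is the
  width of the slopes of the trapezoid in the Powers-Rieffel projection, whose support is an arc of
  length \<open>t + \<delta>\<close>. That the arc is shorter than a quarter of the circle is used for the angle estimate;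
  it also keeps the arc disjoint from its rotation by \<open>2t\<close>.
\<close>

locale powers_rieffel =
  fixes u v :: "'a::cstar_algebra" and t \<delta> :: real
  assumes u: "unitary_elem u" and v: "unitary_elem v"
    and commutation: "v * u = cis (2 * pi * t) *\<^sub>C (u * v)"
    and \<delta>: "0 < \<delta>" "\<delta> < t" "t + \<delta> < 1/4"
begin

text \<open>
  \<open>bump\<close> and \<open>link\<close> are the functions \<open>f\<close> and \<open>g\<close> of the Powers-Rieffel projection
  \<open>g(u) v + f(u) + star v g(u)\<close>. The last summand of \<open>pr\<close> is already written with the function of \<open>u\<close> on
  the left, which is the normal form used for products. The formula for \<open>link\<close> is forced by the
  equation for the constant term of the square, and it is symmetric enough to make \<open>pr\<close> invariant
  under the flip.
\<close>

definition "lam = cis (2 * pi * t)"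
definition "bump z = trapezoid ((t - \<delta>) / 2) ((t + \<delta>) / 2) (angle z)"
definition "link z = sqrt (bump z * bump (lam * z))"
definition "fc h = fun_calc u (\<lambda>z. complex_of_real (h z))"
definition "pr = fc link * v + fc bump + fc (\<lambda>z. link (cnj lam * z)) * star v"

lemma norm_lam [simp]: "norm lam = 1" "norm (cnj lam) = 1"
  by (simp_all add: lam_def)

lemma lam_cancel [simp]: "lam * (cnj lam * z) = z" "cnj lam * (lam * z) = z"
  by (simp_all add: lam_def cis_cnj cis_mult flip: mult.assoc)

lemma v_cancel [simp]: "star v * v = 1" "v * star v = 1" "v * (star v * a) = a" "star v * (v * a) = a"
  using v by (simp_all add: unitary_elem_def flip: mult.assoc)

lemma continuous_rotate:
  assumes "continuous_on circle h" "norm c = 1"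
  shows "continuous_on circle (\<lambda>z. h (c * z))"
  by (rule continuous_on_compose2[OF assms(1)]) (use assms(2) in \<open>auto intro!: continuous_intros simp: norm_mult\<close>)

lemma continuous_bump: "continuous_on circle bump"
  unfolding bump_def trapezoid_def using \<delta> by (intro continuous_intros continuous_angle) auto

lemma continuous_link: "continuous_on circle link"
  unfolding link_def by (intro continuous_intros continuous_bump continuous_rotate) auto

lemmas continuous = continuous_bump continuous_link continuous_rotate continuous_on_mult
  continuous_on_add continuous_on_const continuous_on_real_sqrt

lemma fc_mult: "continuous_on circle h \<Longrightarrow> continuous_on circle k \<Longrightarrow> fc h * fc k = fc (\<lambda>z. h z * k z)"
  unfolding fc_def by (simp add: u fun_calc_mult[symmetric] continuous_on_of_real)

lemma fc_add: "continuous_on circle h \<Longrightarrow> continuous_on circle k \<Longrightarrow> fc h + fc k = fc (\<lambda>z. h z + k z)"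
  unfolding fc_def by (simp add: u fun_calc_add[symmetric] continuous_on_of_real)

lemma fc_cong: "continuous_on circle h \<Longrightarrow> (\<And>z. norm z = 1 \<Longrightarrow> h z = k z) \<Longrightarrow> fc h = fc k"
  unfolding fc_def by (rule fun_calc_cong[OF u]) (auto intro: continuous_on_of_real)

lemma fc_zero: "continuous_on circle h \<Longrightarrow> (\<And>z. norm z = 1 \<Longrightarrow> h z = 0) \<Longrightarrow> fc h = 0"
  using fc_cong[of h "\<lambda>_. 0"] fun_calc_const[OF u, of 0] by (simp add: fc_def)

lemma star_fc: "continuous_on circle h \<Longrightarrow> star (fc h) = fc h"
  unfolding fc_def by (simp add: star_fun_calc u continuous_on_of_real)

lemma v_fc: "continuous_on circle h \<Longrightarrow> v * fc h = fc (\<lambda>z. h (lam * z)) * v"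
  unfolding fc_def using commutation
  by (intro fun_calc_rotate[OF u v]) (auto simp: lam_def intro: continuous_on_of_real)

lemma star_v_fc:
  assumes "continuous_on circle h" shows "star v * fc h = fc (\<lambda>z. h (cnj lam * z)) * star v"
proof -
  have "v * fc (\<lambda>z. h (cnj lam * z)) = fc h * v"
    by (subst v_fc) (use assms in \<open>auto intro: continuous_rotate\<close>)
  then have "star v * (v * fc (\<lambda>z. h (cnj lam * z))) * star v = star v * (fc h * v) * star v"
    by simp
  then show ?thesis by (simp add: mult.assoc)
qed

lemma bump_nonneg: "0 \<le> bump z"
  using \<delta> by (simp add: bump_def trapezoid_nonneg)

lemma bump_support:
  assumes "norm z = 1" "bump z \<noteq> 0"
  obtains x where "z = cis (2*pi*x)" "\<bar>x\<bar> < (t + \<delta>) / 2"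
proof -
  obtain x where x: "\<bar>x\<bar> \<le> 1/2" "z = cis (2*pi*x)"
    using circle_param[OF assms(1)] .
  have "\<bar>x\<bar> < (t + \<delta>) / 2"
    using assms(2) trapezoid_eq_0[of "(t - \<delta>) / 2" "(t + \<delta>) / 2" "\<bar>x\<bar>"] \<delta> x
    by (fastforce simp: bump_def angle_cis)
  with x that show ?thesis by blast
qed

lemma bump_far:
  assumes "norm z = 1" shows "bump z * bump (lam * (lam * z)) = 0"
proof (cases "bump z = 0")
  case False
  then obtain x where x: "z = cis (2*pi*x)" "\<bar>x\<bar> < (t + \<delta>) / 2"
    using bump_support[OF assms] by blast
  have "lam * (lam * z) = cis (2*pi*(x + 2*t))"
    by (simp add: lam_def x(1) cis_mult algebra_simps)
  moreover have "(t + \<delta>) / 2 \<le> angle (cis (2*pi*(x + 2*t)))"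
  proof (rule angle_cis_ge)
    have xb: "x < (t + \<delta>) / 2" "- x < (t + \<delta>) / 2"
      using x(2) by (simp_all only: abs_less_iff)
    show "(t + \<delta>) / 2 \<le> x + 2 * t"
      using \<delta> xb by (simp add: field_simps)
    show "x + 2 * t \<le> 1 - (t + \<delta>) / 2"
      using \<delta> xb by (simp add: field_simps)
    show "0 \<le> (t + \<delta>) / 2"
      using \<delta> xb by (simp add: field_simps)
  qed
  ultimately have "bump (lam * (lam * z)) = 0"
    using \<delta> by (simp add: bump_def trapezoid_eq_0)
  then show ?thesis by simp
qed simp

text \<open>
  On its support, \<open>bump\<close> meets only its two neighbouring rotations, at most one of them at each point,
  and sums to one with it. Together with the separation of \<open>bump\<close> from its rotation by \<open>2t\<close>, this
  contains all the equations that a Powers-Rieffel projection has to satisfy.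
\<close>

lemma bump_partition:
  assumes "norm z = 1" shows "bump z * (bump (cnj lam * z) + bump z + bump (lam * z) - 1) = 0"
proof (cases "bump z = 0")
  case False
  then obtain x where x: "z = cis (2*pi*x)" "\<bar>x\<bar> < (t + \<delta>) / 2"
    using bump_support[OF assms] by blast
  let ?T = "trapezoid ((t - \<delta>) / 2) ((t + \<delta>) / 2)"
  have "lam * z = cis (2*pi*(x + t))" "cnj lam * z = cis (2*pi*(x - t))"
    by (simp_all add: lam_def x(1) cis_cnj cis_mult algebra_simps)
  then have eq: "bump z = ?T \<bar>x\<bar>" "bump (lam * z) = ?T \<bar>x + t\<bar>" "bump (cnj lam * z) = ?T \<bar>x - t\<bar>"
    using x(2) \<delta> by (auto simp: bump_def x(1) angle_cis)
  have compl: "?T y + ?T (t - y) = 1" for y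
    using trapezoid_complement[of "(t - \<delta>) / 2" "(t + \<delta>) / 2" y] \<delta> by (simp add: field_simps)
  have "bump (cnj lam * z) + bump z + bump (lam * z) = 1"
  proof (cases "x \<ge> 0")
    case True
    then have "\<bar>x + t\<bar> \<ge> (t + \<delta>) / 2" "\<bar>x - t\<bar> = t - x" using x(2) \<delta> by auto
    then show ?thesis
      using compl[of x] True \<delta> by (simp add: eq trapezoid_eq_0)
  next
    case False
    then have "\<bar>x - t\<bar> \<ge> (t + \<delta>) / 2" "\<bar>x + t\<bar> = t - \<bar>x\<bar>" using x(2) \<delta> by auto
    then show ?thesis
      using compl[of "\<bar>x\<bar>"] \<delta> by (simp add: eq trapezoid_eq_0)
  qed
  then show ?thesis by simp
qed simp

lemma link_square: "link z * link z = bump z * bump (lam * z)"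
  by (simp add: link_def bump_nonneg)

lemma link_nonneg: "0 \<le> link z"
  by (simp add: link_def bump_nonneg)

lemma link_far: "norm z = 1 \<Longrightarrow> link z * link (lam * z) = 0"
  using bump_far[of z] by (auto simp: link_def)

lemma link_partition:
  assumes "norm z = 1" shows "link z * (bump z + bump (lam * z)) = link z"
proof (cases "link z = 0")
  case False
  then have "bump z \<noteq> 0" "bump (lam * z) \<noteq> 0" by (auto simp: link_def)
  moreover have "bump (cnj lam * z) = 0"
    using bump_far[of "cnj lam * z"] assms \<open>bump (lam * z) \<noteq> 0\<close> by (auto simp: norm_mult)
  ultimately show ?thesis
    using bump_partition[OF assms] by simp
qed simp

lemma star_pr: "star pr = pr"
  by (simp add: pr_def star_add star_mult star_star star_fc v_fc star_v_fc continuous)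

text \<open>
  The square of \<open>pr\<close> is sorted by powers of \<open>v\<close>. The coefficients of \<open>v\<^sup>2\<close> and of its adjoint vanish by
  separation, and the other three reduce to the partition property.
\<close>

lemma pr_idempotent: "pr * pr = pr"
proof -
  let ?g = "fc link" and ?f = "fc bump" and ?g' = "fc (\<lambda>z. link (cnj lam * z))"
  have move: "v * (fc h * a) = fc (\<lambda>z. h (lam * z)) * (v * a)"
    "star v * (fc h * a) = fc (\<lambda>z. h (cnj lam * z)) * (star v * a)"
    if "continuous_on circle h" for h a
    by (simp_all only: v_fc[OF that] star_v_fc[OF that] flip: mult.assoc)
  have merge: "fc h * (fc k * a) = fc (\<lambda>z. h z * k z) * a"
    if "continuous_on circle h" "continuous_on circle k" for h k a
    by (simp only: fc_mult[OF that] flip: mult.assoc)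
  have 1: "fc (\<lambda>z. link z * link (lam * z)) = 0"
    by (rule fc_zero, intro continuous norm_lam, rule link_far)
  have c: "continuous_on circle (\<lambda>z. link (cnj lam * (cnj lam * z)))"
    by (intro continuous norm_lam continuous_rotate[of "\<lambda>z. link (cnj lam * z)"])
  have 2: "fc (\<lambda>z. link (cnj lam * z) * link (cnj lam * (cnj lam * z))) = 0"
  proof (rule fc_zero)
    show "link (cnj lam * z) * link (cnj lam * (cnj lam * z)) = 0" if "norm z = 1" for z
      using link_far[of "cnj lam * (cnj lam * z)"] that by (simp add: norm_mult mult.commute)
  qed (intro continuous norm_lam c)
  have 3: "fc (\<lambda>z. link z * bump (lam * z)) + fc (\<lambda>z. bump z * link z) = ?g"
    by (subst fc_add, intro continuous, simp, intro continuous)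
       (rule fc_cong, (intro continuous; simp), metis distrib_left link_partition add.commute mult.commute)
  have 4: "fc (\<lambda>z. bump z * link (cnj lam * z)) + fc (\<lambda>z. link (cnj lam * z) * bump (cnj lam * z)) = ?g'"
  proof (subst fc_add)
    show "fc (\<lambda>z. bump z * link (cnj lam * z) + link (cnj lam * z) * bump (cnj lam * z)) = ?g'"
    proof (rule fc_cong)
      show "bump z * link (cnj lam * z) + link (cnj lam * z) * bump (cnj lam * z) = link (cnj lam * z)"
        if "norm z = 1" for z
        using link_partition[of "cnj lam * z"] that
        by (simp add: norm_mult distrib_left add.commute mult.commute[of "bump z"])
    qed (intro continuous norm_lam)
  qed (intro continuous norm_lam)+
  have 5: "fc (\<lambda>z. link z * link z) + fc (\<lambda>z. bump z * bump z)
      + fc (\<lambda>z. link (cnj lam * z) * link (cnj lam * z)) = ?f"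
  proof -
    have "link z * link z + bump z * bump z + link (cnj lam * z) * link (cnj lam * z) = bump z"
      if "norm z = 1" for z
      using bump_partition[OF that] unfolding link_square lam_cancel by (simp add: algebra_simps)
    then show ?thesis
      by (subst fc_add, (intro continuous norm_lam)+)+ (rule fc_cong, (intro continuous norm_lam), simp)
  qed
  have "pr * pr = fc (\<lambda>z. link z * link (lam * z)) * (v * v)
      + (fc (\<lambda>z. link z * bump (lam * z)) + fc (\<lambda>z. bump z * link z)) * v
      + (fc (\<lambda>z. link z * link z) + fc (\<lambda>z. bump z * bump z)
         + fc (\<lambda>z. link (cnj lam * z) * link (cnj lam * z)))
      + (fc (\<lambda>z. bump z * link (cnj lam * z)) + fc (\<lambda>z. link (cnj lam * z) * bump (cnj lam * z))) * star v
      + fc (\<lambda>z. link (cnj lam * z) * link (cnj lam * (cnj lam * z))) * (star v * star v)"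
    by (simp add: pr_def distrib_left distrib_right mult.assoc move merge v_fc star_v_fc fc_mult continuous c)
  also have "\<dots> = pr"
    unfolding 1 2 3 4 5 by (simp add: pr_def)
  finally show ?thesis .
qed

lemma projection_pr: "projection pr"
  by (simp add: projection_def star_pr pr_idempotent)

text \<open>
  The projection lives on the support of \<open>bump\<close>: each of its three coefficients does.
\<close>

lemma fc_absorb_left:
  assumes h: "continuous_on circle h" and one: "\<And>z. norm z = 1 \<Longrightarrow> bump z \<noteq> 0 \<Longrightarrow> h z = 1"
  shows "fc h * pr = pr"
proof -
  have absorb: "fc h * (fc k * a) = fc k * a"
    if k: "continuous_on circle k" and supp: "\<And>z. norm z = 1 \<Longrightarrow> bump z = 0 \<Longrightarrow> k z = 0" for k a
  proof -
    have "fc h * fc k = fc k"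
      unfolding fc_mult[OF h k]
    proof (rule fc_cong)
      show "h z * k z = k z" if "norm z = 1" for z
        using one[OF that] supp[OF that] by (cases "bump z = 0") auto
    qed (intro continuous h k)
    then show ?thesis by (simp flip: mult.assoc)
  qed
  have "fc h * fc bump = fc bump"
    using absorb[of bump 1] by (simp add: continuous)
  then show ?thesis
    by (simp add: pr_def distrib_left absorb continuous link_def)
qed

text \<open>
  The off-diagonal terms have trace zero because their coefficient \<open>h\<close> and its rotation are disjoint:
  splitting \<open>h\<close> into two square roots and moving one of them around the trace makes the product vanish.
  The diagonal term contributes the area of the trapezoid.
\<close>

lemma trace_pr:
  assumes \<tau>: "tracial_state \<tau>"
    and moments: "\<And>n i. \<tau> (star u ^ n * u ^ i) = (if n = i then 1 else 0)"
  shows "\<tau> pr = complex_of_real t"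
proof -
  interpret \<tau>: bounded_linear \<tau> using \<tau> by (simp add: tracial_state_def)
  have cyc: "\<tau> (a * b) = \<tau> (b * a)" for a b using \<tau> by (simp add: tracial_state_def)
  have vanish: "\<tau> (fc h * w) = 0"
    if h: "continuous_on circle h" "\<And>z. 0 \<le> h z" and c: "norm c = 1"
      and w: "\<And>k. continuous_on circle k \<Longrightarrow> w * fc k = fc (\<lambda>z. k (c * z)) * w"
      and disj: "\<And>z. norm z = 1 \<Longrightarrow> h z * h (c * z) = 0" for h w c
  proof -
    let ?r = "\<lambda>z. sqrt (h z)"
    have r: "continuous_on circle ?r" by (intro continuous h)
    have "fc h = fc ?r * fc ?r"
      unfolding fc_mult[OF r r] using h by (intro fc_cong) auto
    then have "\<tau> (fc h * w) = \<tau> (fc ?r * (w * fc ?r))"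
      by (metis cyc mult.assoc)
    also have "\<dots> = \<tau> (fc ?r * fc (\<lambda>z. ?r (c * z)) * w)"
      by (simp add: w[OF r] mult.assoc)
    also have "fc ?r * fc (\<lambda>z. ?r (c * z)) = 0"
      unfolding fc_mult[OF r continuous_rotate[OF r c]]
    proof (rule fc_zero)
      show "?r z * ?r (c * z) = 0" if "norm z = 1" for z
        using disj[OF that] by (simp flip: real_sqrt_mult)
    qed (rule continuous_on_mult[OF r continuous_rotate[OF r c]])
    finally show ?thesis by (simp add: \<tau>.zero)
  qed
  have "\<tau> (fc link * v) = 0"
    by (rule vanish[OF continuous_link link_nonneg norm_lam(1) v_fc link_far])
  moreover have "\<tau> (fc (\<lambda>z. link (cnj lam * z)) * star v) = 0"
  proof (rule vanish[OF _ _ norm_lam(2) star_v_fc])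
    show "link (cnj lam * z) * link (cnj lam * (cnj lam * z)) = 0" if "norm z = 1" for z
      using link_far[of "cnj lam * (cnj lam * z)"] that by (simp add: norm_mult mult.commute)
  qed (auto simp: link_nonneg intro: continuous)
  moreover have "\<tau> (fc bump) = complex_of_real t"
  proof -
    have "((\<lambda>x. complex_of_real (bump (cis (2*pi*x)))) has_integral \<tau> (fc bump)) {-1/2..1/2}"
      unfolding fc_def using \<tau> moments
      by (intro fun_calc_trace[OF u]) (auto simp: tracial_state_def intro: continuous_on_of_real continuous_bump)
    moreover have "((\<lambda>x. complex_of_real (bump (cis (2*pi*x)))) has_integral complex_of_real t) {-1/2..1/2}"
    proof -
      have "((\<lambda>x. trapezoid ((t - \<delta>) / 2) ((t + \<delta>) / 2) \<bar>x\<bar>) has_integral t) {-1/2..1/2}"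
        using has_integral_trapezoid[of "(t - \<delta>) / 2" "(t + \<delta>) / 2"] \<delta> by (simp add: field_simps)
      then have "((\<lambda>x. complex_of_real (trapezoid ((t - \<delta>) / 2) ((t + \<delta>) / 2) \<bar>x\<bar>)) has_integral complex_of_real t) {-1/2..1/2}"
        by (rule has_integral_of_real)
      then show ?thesis
        by (rule has_integral_eq[rotated]) (auto simp: bump_def angle_cis)
    qed
    ultimately show ?thesis by (rule has_integral_unique)
  qed
  ultimately show ?thesis
    by (simp add: pr_def \<tau>.add)
qed

text \<open>
  The flip replaces \<open>z\<close> by its conjugate. It fixes the even function \<open>bump\<close> and exchanges the two
  off-diagonal terms.
\<close>

lemma flip_pr:
  assumes \<phi>: "unital_star_hom \<phi>" "\<phi> u = star u" "\<phi> v = star v"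
  shows "\<phi> pr = pr"
proof -
  have \<phi>_fc: "\<phi> (fc h) = fc (\<lambda>z. h (cnj z))" if "continuous_on circle h" for h
    unfolding fc_def using fun_calc_hom[OF \<phi>(1) u, of "\<lambda>z. complex_of_real (h z)"] that
    by (simp add: \<phi>(2) fun_calc_star_unitary u continuous_on_of_real)
  have bump_cnj: "bump (cnj z) = bump z" for z
    by (simp add: bump_def angle_cnj)
  have link_cnj: "link (cnj z) = link (cnj lam * z)" for z
    using bump_cnj[of "lam * cnj z"] unfolding link_def lam_cancel by (simp add: bump_cnj mult.commute)
  have link_cnj': "link (cnj lam * cnj z) = link z" for z
    using link_cnj[of "lam * z"] by simp
  have "\<phi> pr = fc (\<lambda>z. link (cnj lam * z)) * star v + fc bump + fc link * v"
    using \<phi> by (simp add: pr_def unital_star_hom_def \<phi>_fc continuous bump_cnj link_cnj link_cnj' star_star)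
  then show ?thesis by (simp add: pr_def add.commute add.left_commute)
qed

section \<open>The angle between the projection and its Fourier transform\<close>

text \<open>
  Rotation by \<open>2t\<close> moves the support of the projection off itself. A cut-off \<open>h\<close> that is one on the
  support and vanishes outside the arc \<open>\<bar>x\<bar> < t\<close> exhibits this; the arc and its rotation by \<open>2t\<close> are
  disjoint because \<open>4 t < 1\<close>.
\<close>

lemma pr_v_v_pr: "pr * (v * (v * pr)) = 0"
proof -
  define h where "h z = trapezoid ((t + \<delta>) / 2) t (angle z)" for z
  have h: "continuous_on circle h"
    unfolding h_def trapezoid_def using \<delta> by (intro continuous_intros continuous_angle) auto
  have "fc h * pr = pr"
  proof (rule fc_absorb_left[OF h])
    show "h z = 1" if "norm z = 1" "bump z \<noteq> 0" for z
    proof -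
      have "angle z < (t + \<delta>) / 2"
        using that(2) trapezoid_eq_0[of "(t - \<delta>) / 2" "(t + \<delta>) / 2" "angle z"] \<delta>
        by (fastforce simp: bump_def)
      then show ?thesis using \<delta> by (simp add: h_def trapezoid_eq_1)
    qed
  qed
  moreover from this have "pr * fc h = pr"
    using star_mult[of "fc h" pr] by (simp add: star_fc h star_pr)
  ultimately have "pr * (v * (v * pr)) = pr * fc h * (v * (v * (fc h * pr)))"
    by simp
  also have "\<dots> = pr * (fc h * (v * (v * fc h))) * pr"
    by (simp add: mult.assoc)
  also have "fc h * (v * (v * fc h)) = fc h * (v * fc (\<lambda>z. h (lam * z))) * v"
    by (simp add: v_fc[OF h] mult.assoc)
  also have "\<dots> = fc h * fc (\<lambda>z. h (lam * (lam * z))) * v * v"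
    by (simp add: v_fc[OF continuous_rotate[OF h norm_lam(1)]] mult.assoc)
  also have "fc h * fc (\<lambda>z. h (lam * (lam * z))) = 0"
  proof -
    have c: "continuous_on circle (\<lambda>z. h (lam * (lam * z)))"
      by (intro continuous_rotate[of "\<lambda>z. h (lam * z)"] continuous_rotate[OF h] norm_lam)
    show ?thesis
      unfolding fc_mult[OF h c]
    proof (rule fc_zero)
      fix z :: complex assume "norm z = 1"
      then obtain x where x: "\<bar>x\<bar> \<le> 1/2" "z = cis (2*pi*x)"
        using circle_param by blast
      show "h z * h (lam * (lam * z)) = 0"
      proof (cases "\<bar>x\<bar> < t")
        case True
        then have xt: "x < t" "- x < t" by (simp_all only: abs_less_iff)
        have "lam * (lam * z) = cis (2*pi*(x + 2*t))"
          by (simp add: lam_def x(2) cis_mult algebra_simps)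
        moreover have "t \<le> angle (cis (2*pi*(x + 2*t)))"
          using xt \<delta> by (intro angle_cis_ge) linarith+
        ultimately show ?thesis
          using \<delta> by (simp add: h_def trapezoid_eq_0)
      next
        case False
        then show ?thesis using \<delta> x by (simp add: h_def angle_cis trapezoid_eq_0)
      qed
    qed (intro continuous_on_mult h c)
  qed
  finally show ?thesis by simp
qed

text \<open>
  Compressed by the projection, \<open>(v + star v)\<^sup>2 = 2 + v\<^sup>2 + (star v)\<^sup>2\<close> is the constant \<open>2\<close>.
\<close>

lemma norm_pr_cosine_le: "norm (pr * (v + star v)) \<le> sqrt 2"
proof -
  have 0: "pr * (star v * (star v * pr)) = 0"
    using arg_cong[OF pr_v_v_pr, of star] by (simp add: star_mult star_pr mult.assoc)
  have "(pr * (v + star v)) * star (pr * (v + star v)) = 2 *\<^sub>R pr"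
    by (simp add: star_mult star_add star_star star_pr distrib_left distrib_right mult.assoc
        pr_v_v_pr 0 pr_idempotent scaleR_2)
  then have "(norm (pr * (v + star v)))\<^sup>2 \<le> 2"
    using norm_mult_star[of "pr * (v + star v)"] norm_projection_le[OF projection_pr] by simp
  then show ?thesis
    by (rule real_le_rsqrt)
qed

text \<open>
  Two estimates compete. By the previous lemma, \<open>v + star v\<close> has norm at most \<open>sqrt 2\<close> next to \<open>pr\<close>. Next
  to the Fourier transform of \<open>pr\<close>, a projection that lives on a short arc of the spectrum of \<open>v\<close>, it is
  the multiplication by twice a cosine, which is larger than \<open>sqrt 2\<close> there because the arc reaches
  less than an eighth of the circle to each side of \<open>1\<close>. Dividing by this cosine inside the product
  \<open>pr * \<sigma> pr\<close> yields the claim.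
\<close>

lemma norm_pr_fourier_lt_1:
  assumes \<sigma>: "unital_star_hom \<sigma>" "\<sigma> u = v"
  shows "norm (pr * \<sigma> pr) < 1"
proof -
  define \<kappa> where "\<kappa> = cos (2 * pi * ((t + \<delta>) / 2))"
  have \<kappa>: "\<kappa> > sqrt 2 / 2"
  proof -
    have "pi * (t + \<delta>) < pi * (1/4)"
      using \<delta> by (intro mult_strict_left_mono) auto
    then show ?thesis
      unfolding \<kappa>_def cos_45[symmetric] using \<delta> by (intro cos_monotone_0_pi) auto
  qed
  then have \<kappa>0: "\<kappa> > 0" by (smt (verit) real_sqrt_gt_zero divide_pos_pos)
  \<comment> \<open>The reciprocal of \<open>2 * Re z\<close> on the support, cut off to be bounded by \<open>1 / (2 * \<kappa>)\<close> everywhere.\<close>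
  define m where "m z = 1 / (2 * max (Re z) \<kappa>)" for z
  have m: "continuous_on circle m"
    unfolding m_def using \<kappa>0 by (intro continuous_intros) (auto simp: max_def)
  have cos: "continuous_on circle (\<lambda>z. 2 * Re z)" by (intro continuous_intros)
  have "fc (\<lambda>z. 2 * Re z * m z) * pr = pr"
  proof (rule fc_absorb_left)
    show "2 * Re z * m z = 1" if "norm z = 1" "bump z \<noteq> 0" for z
    proof -
      have "angle z < (t + \<delta>) / 2"
        using that(2) trapezoid_eq_0[of "(t - \<delta>) / 2" "(t + \<delta>) / 2" "angle z"] \<delta>
        by (fastforce simp: bump_def)
      then have "\<kappa> \<le> Re z"
        unfolding \<kappa>_def using \<delta> by (intro cos_le_Re that) auto
      then show ?thesis using \<kappa>0 by (simp add: m_def max_def)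
    qed
  qed (intro continuous_on_mult cos m)
  moreover have "fc (\<lambda>z. 2 * Re z * m z) = (u + star u) * fc m"
  proof -
    have "laurent u (\<lambda>z. z + cnj z) (u + star u)"
      by (intro laurent.intros)
    then have "fun_calc u (\<lambda>z. z + cnj z) = u + star u"
      by (intro fun_calc_eqI[OF u] laurent_imp_limit)
    then have "fc (\<lambda>z. 2 * Re z) = u + star u"
      by (simp add: fc_def complex_add_cnj)
    then show ?thesis by (simp add: fc_mult[OF cos m, symmetric])
  qed
  ultimately have "\<sigma> ((u + star u) * fc m * pr) = \<sigma> pr" by simp
  then have \<sigma>pr: "(v + star v) * \<sigma> (fc m) * \<sigma> pr = \<sigma> pr"
    using \<sigma> by (simp add: unital_star_hom_def)
  have "norm (\<sigma> (fc m)) \<le> 1 / (2 * \<kappa>)"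
  proof -
    have cm: "continuous_on circle (\<lambda>z. complex_of_real (m z))"
      by (rule continuous_on_of_real[OF m])
    have "norm (complex_of_real (m z)) \<le> 1 / (2 * \<kappa>)" for z
      using \<kappa>0 unfolding norm_of_real m_def by (auto simp: max_def abs_le_iff field_simps)
    then show ?thesis
      unfolding fc_def fun_calc_hom[OF \<sigma>(1) u cm] \<sigma>(2) by (intro norm_fun_calc_le[OF v cm])
  qed
  moreover have "norm (\<sigma> pr) \<le> 1"
  proof (rule norm_projection_le)
    show "projection (\<sigma> pr)"
      using \<sigma>(1) projection_pr unfolding projection_def unital_star_hom_def by metis
  qed
  ultimately have "norm (pr * (v + star v)) * (norm (\<sigma> (fc m)) * norm (\<sigma> pr)) \<le> sqrt 2 * (1 / (2 * \<kappa>) * 1)"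
    using \<kappa>0 by (intro mult_mono norm_pr_cosine_le) auto
  also have "\<dots> < 1"
    using \<kappa> \<kappa>0 by (simp add: field_simps)
  finally have *: "norm (pr * (v + star v)) * (norm (\<sigma> (fc m)) * norm (\<sigma> pr)) < 1" .
  have "norm (pr * \<sigma> pr) = norm (pr * (v + star v) * (\<sigma> (fc m) * \<sigma> pr))"
    using \<sigma>pr by (simp add: mult.assoc)
  also have "\<dots> \<le> norm (pr * (v + star v)) * (norm (\<sigma> (fc m)) * norm (\<sigma> pr))"
    by (intro order_trans[OF norm_mult_ineq] mult_left_mono norm_mult_ineq norm_ge_zero)
  finally show ?thesis using * by simp
qed

end

section \<open>Monomials in the generators of a rotation algebra\<close>

lemma unitary_power_0 [simp]: "unitary_power u 0 = 1"
  by (simp add: unitary_power_def)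

lemma unitary_power_succ:
  assumes "unitary_elem u" shows "unitary_power u (a + 1) = u * unitary_power u a"
proof (cases "a \<ge> 0")
  case True
  then show ?thesis by (simp add: unitary_power_def nat_add_distrib)
next
  case False
  define n where "n = nat (- a - 1)"
  have a: "a = - int (Suc n)" using False by (simp add: n_def)
  have "u * star u ^ Suc n = star u ^ n"
    using assms by (simp add: unitary_elem_def flip: mult.assoc)
  moreover have "unitary_power u (a + 1) = star u ^ n"
    by (cases n) (auto simp: a unitary_power_def nat_add_distrib)
  moreover have "unitary_power u a = star u ^ Suc n"
    by (auto simp: a unitary_power_def nat_add_distrib)
  ultimately show ?thesis by simp
qed

lemma unitary_power_pred:
  assumes "unitary_elem u" shows "unitary_power u (a - 1) = star u * unitary_power u a"
  using unitary_power_succ[OF assms, of "a - 1"] assms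
  by (simp add: unitary_elem_def flip: mult.assoc)

lemma unitary_power_add:
  assumes "unitary_elem u" shows "unitary_power u (a + b) = unitary_power u a * unitary_power u b"
proof (induction a rule: int_induct[where k = 0])
  case (step1 i)
  then show ?case
    using unitary_power_succ[OF assms, of "i + b"] unitary_power_succ[OF assms, of i]
    by (simp add: algebra_simps)
next
  case (step2 i)
  then show ?case
    using unitary_power_pred[OF assms, of "i + b"] unitary_power_pred[OF assms, of i]
    by (simp add: algebra_simps)
qed simp

lemma unitary_power_star: "unitary_power (star u) a = unitary_power u (- a)"
  by (simp add: unitary_power_def star_star)

lemma star_unitary_power: "star (unitary_power u a) = unitary_power u (- a)"
  by (simp add: unitary_power_def star_star star_power)

lemma unitary_elem_unitary_power: "unitary_elem u \<Longrightarrow> unitary_elem (unitary_power u a)"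
  using unitary_power_add[of u "- a" a] unitary_power_add[of u a "- a"]
  by (simp add: unitary_elem_def star_unitary_power)

lemma unital_star_hom_unitary_power:
  assumes "unital_star_hom f" shows "f (unitary_power u a) = unitary_power (f u) a"
proof -
  have f: "f 1 = 1" "f (a * b) = f a * f b" "f (star a) = star (f a)" for a b
    using assms by (auto simp: unital_star_hom_def)
  have "f (b ^ n) = f b ^ n" for b n
    by (induction n) (auto simp: f)
  then show ?thesis by (simp add: unitary_power_def f)
qed

lemma unitary_elem_mult:
  assumes "unitary_elem u" "unitary_elem v" shows "unitary_elem (u * v)"
proof -
  have "star v * (star u * u) * v = 1" "u * (v * star v) * star u = 1"
    using assms by (auto simp: unitary_elem_def)
  then show ?thesis by (simp add: unitary_elem_def star_mult mult.assoc)
qed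

lemma unitary_elem_cis: "unitary_elem u \<Longrightarrow> unitary_elem (cis x *\<^sub>C u)"
  by (simp add: unitary_elem_def star_scaleC mult_scaleC_left mult_scaleC_right scaleC_scaleC cis_cnj cis_mult)

text \<open>
  Applied a second time, with a power of \<open>u\<close> in place of \<open>v\<close> and \<open>v\<close> in place of \<open>u\<close>, this gives the
  commutation of arbitrary powers.
\<close>

lemma commute_unitary_power:
  assumes u: "unitary_elem u" and comm: "v * u = cis \<alpha> *\<^sub>C (u * v)"
  shows "v * unitary_power u c = cis (\<alpha> * c) *\<^sub>C (unitary_power u c * v)"
proof (induction c rule: int_induct[where k = 0])
  case (step1 i)
  have "v * unitary_power u (i + 1) = cis \<alpha> *\<^sub>C (u * (v * unitary_power u i))"
    by (simp add: unitary_power_succ u comm mult_scaleC_left flip: mult.assoc)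
  moreover have "unitary_power u (1 + i) = u * unitary_power u i"
    using unitary_power_succ[OF u, of i] by (simp add: add.commute)
  ultimately show ?case
    by (simp add: step1 mult_scaleC_right scaleC_scaleC cis_mult mult.assoc distrib_left add.commute)
next
  case (step2 i)
  have "star u * v = star u * (v * u) * star u"
    using u by (simp add: unitary_elem_def mult.assoc)
  also have "\<dots> = cis \<alpha> *\<^sub>C (star u * u * v * star u)"
    by (simp add: comm mult_scaleC_left mult_scaleC_right mult.assoc)
  also have "\<dots> = cis \<alpha> *\<^sub>C (v * star u)"
    using u by (simp add: unitary_elem_def)
  finally have "star u * v = cis \<alpha> *\<^sub>C (v * star u)" .
  then have *: "v * star u = cis (- \<alpha>) *\<^sub>C (star u * v)"
    by (simp add: scaleC_scaleC cis_mult)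
  have "v * unitary_power u (i - 1) = cis (- \<alpha>) *\<^sub>C (star u * (v * unitary_power u i))"
    by (simp add: unitary_power_pred u * mult_scaleC_left flip: mult.assoc)
  then show ?case
    by (simp add: step2 unitary_power_pred u mult_scaleC_right scaleC_scaleC cis_mult mult.assoc algebra_simps)
qed simp

lemma unitary_power_commute_unitary_power:
  assumes u: "unitary_elem u" and v: "unitary_elem v" and comm: "v * u = cis \<alpha> *\<^sub>C (u * v)"
  shows "unitary_power v b * unitary_power u c
    = cis (\<alpha> * b * c) *\<^sub>C (unitary_power u c * unitary_power v b)"
proof -
  let ?w = "unitary_power u c"
  have "v * ?w = cis (\<alpha> * c) *\<^sub>C (?w * v)"
    by (rule commute_unitary_power[OF u comm])
  then have "?w * v = cis (- (\<alpha> * c)) *\<^sub>C (v * ?w)"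
    by (simp add: scaleC_scaleC cis_mult)
  then have "?w * unitary_power v b = cis (- (\<alpha> * c) * b) *\<^sub>C (unitary_power v b * ?w)"
    by (rule commute_unitary_power[OF v])
  then show ?thesis
    by (simp add: scaleC_scaleC cis_mult algebra_simps)
qed

lemma monomial_mult:
  assumes u: "unitary_elem u" and v: "unitary_elem v" and comm: "v * u = cis \<alpha> *\<^sub>C (u * v)"
  shows "unitary_power u a * unitary_power v b * (unitary_power u c * unitary_power v d)
    = cis (\<alpha> * b * c) *\<^sub>C (unitary_power u (a + c) * unitary_power v (b + d))"
proof -
  have "unitary_power u a * unitary_power v b * (unitary_power u c * unitary_power v d)
      = unitary_power u a * (unitary_power v b * unitary_power u c) * unitary_power v d"
    by (simp add: mult.assoc)
  then show ?thesis
    by (simp add: unitary_power_commute_unitary_power[OF assms] unitary_power_add u v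
        mult_scaleC_left mult_scaleC_right mult.assoc)
qed

lemma monomial_power:
  assumes u: "unitary_elem u" and v: "unitary_elem v" and comm: "v * u = cis \<alpha> *\<^sub>C (u * v)"
  shows "\<exists>c. (z *\<^sub>C (unitary_power u a * unitary_power v b)) ^ j
    = c *\<^sub>C (unitary_power u (int j * a) * unitary_power v (int j * b))"
proof (induction j)
  case 0
  show ?case by (rule exI[of _ 1]) simp
next
  case (Suc j)
  then obtain c where "(z *\<^sub>C (unitary_power u a * unitary_power v b)) ^ j
    = c *\<^sub>C (unitary_power u (int j * a) * unitary_power v (int j * b))" by blast
  then show ?case
    by (auto simp: mult_scaleC_left mult_scaleC_right scaleC_scaleC monomial_mult[OF assms] distrib_right)
qed

text \<open>
  The monomial \<open>U ^ m * V ^ n\<close> and its Fourier transform satisfy the relations of the rotation algebra for \<open>(m\<^sup>2 + n\<^sup>2) \<theta>\<close>: the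
  exponent vectors \<open>(m, n)\<close> and \<open>(-n, m)\<close> have determinant \<open>m\<^sup>2 + n\<^sup>2\<close>. The square of \<open>\<sigma>\<close> sends the
  monomial to its inverse up to the phase \<open>cis (2 * pi * \<theta> * m * n)\<close>; rescaling by a square root of this phase turns \<open>\<sigma>\<close>
  into the Fourier transform of the new pair.
\<close>

lemma fourier_pair:
  fixes U V :: "'a::cstar_algebra" and m n :: int
  assumes U: "unitary_elem U" and V: "unitary_elem V"
    and comm: "V * U = cis (2 * pi * \<theta>) *\<^sub>C (U * V)"
    and \<sigma>: "unital_star_hom \<sigma>" "\<sigma> U = V" "\<sigma> V = star U"
    and \<tau>: "canonical_trace U V \<tau>" and mn: "(m, n) \<noteq> (0, 0)"
  obtains u where "unitary_elem u" "\<sigma> (\<sigma> u) = star u"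
    "\<sigma> u * u = cis (2 * pi * ((of_int m ^ 2 + of_int n ^ 2) * \<theta>)) *\<^sub>C (u * \<sigma> u)"
    "\<And>i j. \<tau> (star u ^ i * u ^ j) = (if i = j then 1 else 0)"
proof -
  define \<alpha> where "\<alpha> = 2 * pi * \<theta>"
  have comm': "V * U = cis \<alpha> *\<^sub>C (U * V)" using comm by (simp add: \<alpha>_def)
  have scale: "\<sigma> (z *\<^sub>C a) = z *\<^sub>C \<sigma> a" and mult: "\<sigma> (a * b) = \<sigma> a * \<sigma> b" for z a b
    using \<sigma>(1) by (auto simp: unital_star_hom_def)
  note power = unital_star_hom_unitary_power[OF \<sigma>(1)]
  \<comment> \<open>Half of the phase by which \<open>\<sigma> (\<sigma> u) = star u\<close> would otherwise fail.\<close>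
  define \<beta> where "\<beta> = \<alpha> * m * n / 2"
  define u where "u = cis \<beta> *\<^sub>C (unitary_power U m * unitary_power V n)"
  have unitary: "unitary_elem u"
    unfolding u_def by (intro unitary_elem_cis unitary_elem_mult unitary_elem_unitary_power U V)
  have \<sigma>u: "\<sigma> u = cis (- \<beta>) *\<^sub>C (unitary_power U (- n) * unitary_power V m)"
    using unitary_power_commute_unitary_power[OF U V comm', of m "- n"]
    by (simp add: u_def scale mult power \<sigma> unitary_power_star scaleC_scaleC cis_mult \<beta>_def field_simps)
  have star_u: "star u = cis (- \<beta>) *\<^sub>C (unitary_power V (- n) * unitary_power U (- m))"
    by (simp add: u_def star_scaleC star_mult star_unitary_power cis_cnj)
  have flip: "\<sigma> (\<sigma> u) = star u"
    by (simp add: \<sigma>u star_u scale mult power \<sigma> unitary_power_star)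
  have "\<sigma> u * u = cis (\<alpha> * m * m) *\<^sub>C (unitary_power U (m - n) * unitary_power V (m + n))"
    "u * \<sigma> u = cis (- (\<alpha> * n * n)) *\<^sub>C (unitary_power U (m - n) * unitary_power V (m + n))"
    unfolding \<sigma>u unfolding u_def mult_scaleC_left mult_scaleC_right scaleC_scaleC cis_mult
      monomial_mult[OF U V comm']
    by (simp_all add: add.commute)
  then have comm_u: "\<sigma> u * u = cis (2 * pi * ((of_int m ^ 2 + of_int n ^ 2) * \<theta>)) *\<^sub>C (u * \<sigma> u)"
    by (simp add: scaleC_scaleC cis_mult \<alpha>_def power2_eq_square algebra_simps)
  have \<tau>_scale: "\<tau> (z *\<^sub>C a) = z * \<tau> a" and \<tau>_one: "\<tau> 1 = 1" for z a
    using \<tau> by (auto simp: canonical_trace_def tracial_state_def)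
  have moments: "\<tau> (star u ^ i * u ^ j) = (if i = j then 1 else 0)" for i j
  proof (cases "i = j")
    case True
    then show ?thesis by (simp add: star_power_mult_power unitary \<tau>_one)
  next
    case False
    obtain c where c: "u ^ j = c *\<^sub>C (unitary_power U (int j * m) * unitary_power V (int j * n))"
      using monomial_power[OF U V comm'] unfolding u_def by blast
    have "star u = (cis (- \<beta>) * cis (\<alpha> * m * n)) *\<^sub>C (unitary_power U (- m) * unitary_power V (- n))"
      using unitary_power_commute_unitary_power[OF U V comm', of "- n" "- m"]
      by (simp add: star_u scaleC_scaleC mult_ac)
    then obtain d where d: "star u ^ i = d *\<^sub>C (unitary_power U (int i * - m) * unitary_power V (int i * - n))"
      using monomial_power[OF U V comm'] by metis
    have "\<exists>b. star u ^ i * u ^ j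
        = b *\<^sub>C (unitary_power U ((int j - int i) * m) * unitary_power V ((int j - int i) * n))"
      by (simp add: c d mult_scaleC_left mult_scaleC_right scaleC_scaleC monomial_mult[OF U V comm'])
         (auto simp: algebra_simps)
    moreover have "((int j - int i) * m, (int j - int i) * n) \<noteq> (0, 0)"
      using False mn by auto
    ultimately show ?thesis
      using \<tau> False by (auto simp: canonical_trace_def \<tau>_scale)
  qed
  show ?thesis
    by (rule that[OF unitary flip comm_u moments])
qed

theorem corollary1p2:
  fixes \<theta> t :: real
    and U V :: "'a::cstar_algebra"
    and \<sigma> :: "'a \<Rightarrow> 'a"
    and \<tau> :: "'a \<Rightarrow> complex"
  assumes "0 < \<theta>" and "\<theta> < 1"
    and "rotation_algebra \<theta> U V"
    and "fourier_automorphism U V \<sigma>"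
    and "canonical_trace U V \<tau>"
    and "t \<in> {(of_int m ^ 2 + of_int n ^ 2) * \<theta> + of_int k | m n k :: int. True} \<inter> {0<..<0.2345}"
  shows "\<exists>e. projection e \<and> \<tau> e = complex_of_real t \<and> e * \<sigma> e = 0 \<and> \<sigma> (\<sigma> e) = e \<and>
    projection (e + \<sigma> e) \<and> \<sigma> (e + \<sigma> e) = e + \<sigma> e"
proof -
  obtain m n k :: int where t: "t = (of_int m ^ 2 + of_int n ^ 2) * \<theta> + of_int k"
    and t_pos: "0 < t" and t_less: "t < 0.2345"
    using assms(6) by auto
  have U: "unitary_elem U" and V: "unitary_elem V"
    and comm: "V * U = cis (2 * pi * \<theta>) *\<^sub>C (U * V)"
    using assms(3) by (simp_all add: rotation_algebra_def Let_def cis_conv_exp mult_ac)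
  have \<sigma>: "unital_star_hom \<sigma>" "\<sigma> U = V" "\<sigma> V = star U"
    using assms(4)
    by (simp_all add: fourier_automorphism_def star_automorphism_def unital_star_hom_def unitary_power_def)
  have \<tau>: "tracial_state \<tau>"
    using assms(5) by (simp add: canonical_trace_def)
  \<comment> \<open>Otherwise \<open>t\<close> would be an integer.\<close>
  have mn: "(m, n) \<noteq> (0, 0)"
  proof
    assume "(m, n) = (0, 0)"
    then have "0 < k" "real_of_int k < 1" using t t_pos t_less by auto
    then show False by linarith
  qed
  obtain u where u_facts: "unitary_elem u" "\<sigma> (\<sigma> u) = star u"
    "\<sigma> u * u = cis (2 * pi * ((of_int m ^ 2 + of_int n ^ 2) * \<theta>)) *\<^sub>C (u * \<sigma> u)"
    and moments: "\<And>i j. \<tau> (star u ^ i * u ^ j) = (if i = j then 1 else 0)"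
    using fourier_pair[OF U V comm \<sigma> assms(5) mn] by blast
  have "cis (2 * pi * t) = cis (2 * pi * ((of_int m ^ 2 + of_int n ^ 2) * \<theta>)) * cis (2 * pi * of_int k)"
    by (simp add: t cis_mult algebra_simps)
  then have comm_t: "\<sigma> u * u = cis (2 * pi * t) *\<^sub>C (u * \<sigma> u)"
    by (simp add: u_facts(3) cis_multiple_2pi)
  define \<delta> where "\<delta> = min (t / 2) ((1/4 - t) / 2)"
  interpret powers_rieffel u "\<sigma> u" t \<delta>
  proof unfold_locales
    show "0 < \<delta>" "\<delta> < t" "t + \<delta> < 1/4"
      using t_pos t_less by (auto simp: \<delta>_def min_def field_simps)
  qed (use u_facts comm_t \<sigma>(1) in \<open>auto intro: unital_star_hom_unitary\<close>)
  have "\<sigma> (\<sigma> pr) = pr"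
  proof (rule flip_pr)
    show "unital_star_hom (\<lambda>a. \<sigma> (\<sigma> a))"
      using \<sigma>(1) by (simp add: unital_star_hom_def)
    show "\<sigma> (\<sigma> (\<sigma> u)) = star (\<sigma> u)"
      using \<sigma>(1) u_facts(2) by (simp add: unital_star_hom_def)
  qed (rule u_facts(2))
  then show ?thesis
    using orthogonalize_projection[OF \<sigma>(1) \<tau> projection_pr _ norm_pr_fourier_lt_1[OF \<sigma>(1) refl]]
      trace_pr[OF \<tau> moments] by simp
qed

end
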